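(* Let $t\ge3$ and $q\ge t$. Let $\Sigma$ be a $q$-order canonical subgeometry of $\mathrm{PG}(t-1,q^t)$, $\Gamma$ a $(t-3)$-subspace and $\ell_0$ a line with $\Sigma\cap\Gamma=\emptyset=\ell_0\cap\Gamma$, such that $\mathbb{L}=p_{\Gamma,\ell_0}(\Sigma)$ is a scattered $\mathbb{F}_q$-linear set of pseudoregulus type in $\ell_0\cong\mathrm{PG}(1,q^t)$, and let $r$ be a $q$-order subline of $\ell_0$ contained in $\mathbb{L}$. Then $\Sigma\cap p^{-1}_{\Gamma,\ell_0}(r)$ is a normal rational curve in some subspace of $\Sigma$. More precisely, suppose coordinates are such that $\Sigma=\{\langle(\lambda,\lambda^\sigma,\ldots,\lambda^{\sigma^{t-1}})\rangle_{q^t}:\lambda\in\mathbb{F}_{q^t}^*\}$ with $\sigma:x\mapsto x^{q^\nu}$, $\gcd(\nu,t)=1$, $\Gamma$ has equations $X_{t-1}=X_t=0$ and $\ell_0$ has equations $X_1=\cdots=X_{t-2}=0$, so that in the coordinates $(x_{t-1},x_t)$ of $\ell_0$ one has $\mathbb{L}=\{\langle(\mu,\mu^\sigma)\rangle_{q^t}:\mu\in\mathbb{F}_{q^t}^*\}$; and let $h\in\{0,\ldots,t-1\}$ be such that some line transversal to the regulus $\{\mathcal{F}(X):X\in r\}$ is contained in a member of $\mathcal{S}_h$. Then there is a divisor $m>1$ of $t$ such that $\Sigma\cap p^{-1}_{\Gamma,\ell_0}(r)$ is a normal rational curve of order $n$ in some $n$-subspace of $\Sigma$, where $1\le n\le m-1$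 and $n\equiv h\nu^{-1}\pmod m$ ($\nu^{-1}$ the inverse of $\nu$ modulo $m$).
   Context: A $q$-order canonical subgeometry of $\mathrm{PG}(t-1,q^t)=\mathrm{PG}_{q^t}(V)$ is $\{\langle w\rangle_{q^t}:w\in W\setminus\{0\}\}$ for a $t$-dimensional $\mathbb{F}_q$-subspace $W$ whose points span the space; it is isomorphic to $\mathrm{PG}(t-1,q)$, and its subspaces and normal rational curves are taken in this $\mathrm{PG}(t-1,q)$ (a normal rational curve of order $n$ in $\mathrm{PG}(n,q)$ is a projective image of $\{\langle(1,\lambda,\ldots,\lambda^n)\rangle:\lambda\in\mathbb{F}_q\}\cup\{\langle(0,\ldots,0,1)\rangle\}$). $p_{\Gamma,\ell_0}(X)=\{\langle\Gamma,P\rangle\cap\ell_0:P\in X\}$ and $p^{-1}_{\Gamma,\ell_0}(r)$ is the set of points $P\notin\Gamma$ with $\langle\Gamma,P\rangle\cap\ell_0\in r$. Scattered $\mathbb{F}_q$-linear set of rank $n$ in $\mathrm{PG}(1,q^t)$: $\{\langle u\rangle_{q^t}:\langle u\rangle_{q^t}\cap U\neq\{0\}\}$, $U$ an $n$-dimensional $\mathbb{F}_q$-subspace of $\mathbb{F}_{q^t}^2$, of size $(q^n-1)/(q-1)$; pseudoregulus type: projectively equivalent to $\{\langle(\lambda,\lambda^q)\rangle_{q^t}:\lambda\neq0\}$. A $q$-order subline is a set projectively equivalent to $\{\langle(a,b)\rangle:(a,b)\in\mathbb{F}_q^2\setminus\{0\}\}$. $\mathrm{PG}(2t-1,q)=\mathrm{PG}_q(\mathbb{F}_{q^t}^2)$;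 the field reduction maps $X=\langle(a,b)\rangle_{q^t}$ to $\mathcal{F}(X)=\{\langle(za,zb)\rangle_q:z\in\mathbb{F}_{q^t}^*\}$; for a subline $r$ the spaces $\mathcal{F}(X)$, $X\in r$, form a regulus, and a transversal line is a line of $\mathrm{PG}(2t-1,q)$ meeting each of them. $N(k)=k^{(q^t-1)/(q-1)}$; $S_{h,k}=\{\langle(z,kz^{q^h})\rangle_q:z\in\mathbb{F}_{q^t}^*\}$ and $\mathcal{S}_h=\{S_{h,k}:N(k)=1\}$. *)

theory Defs
  imports "HOL-Analysis.Analysis" "HOL-Number_Theory.Number_Theory"
begin

text \<open>
  The field with \<open>q\<close> elements is a field type \<open>'f\<close> with \<open>CARD('f) = q\<close>, its extension of degree
  \<open>t\<close> is a field type \<open>'k\<close> with \<open>CARD('k) = q ^ t\<close>, and \<open>emb\<close> is the inclusion of the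
  former in the latter.  Subspaces, spans and dimensions over \<open>'k\<close> are those of \<open>vec\<close>
  (scalar multiplication \<open>*s\<close>); over \<open>'f\<close> they are those of the library locales \<open>module\<close> and
  \<open>vector_space\<close> for the restricted scalar multiplication \<open>fscale emb\<close>.
\<close>

definition field_embedding :: "('f::field \<Rightarrow> 'k::field) \<Rightarrow> bool" where
  "field_embedding emb \<longleftrightarrow>
     emb 1 = 1 \<and> (\<forall>x y. emb (x + y) = emb x + emb y) \<and> (\<forall>x y. emb (x * y) = emb x * emb y)"

definition fscale :: "('f::field \<Rightarrow> 'k::field) \<Rightarrow> 'f \<Rightarrow> 'k ^ 'n \<Rightarrow> 'k ^ 'n" where
  "fscale emb c v = emb c *s v"

lemma vector_space_fscale:
  assumes "field_embedding emb"
  shows "vector_space (fscale emb :: 'f::field \<Rightarrow> 'k::field ^ 'n \<Rightarrow> 'k ^ 'n)"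
  using assms
  by unfold_locales
     (auto simp: field_embedding_def fscale_def vec_eq_iff algebra_simps)

abbreviation fsubspace :: "('f::field \<Rightarrow> 'k::field) \<Rightarrow> ('k ^ 'n) set \<Rightarrow> bool" where
  "fsubspace emb \<equiv> module.subspace (fscale emb)"

abbreviation fspan :: "('f::field \<Rightarrow> 'k::field) \<Rightarrow> ('k ^ 'n) set \<Rightarrow> ('k ^ 'n) set" where
  "fspan emb \<equiv> module.span (fscale emb)"

abbreviation findependent :: "('f::field \<Rightarrow> 'k::field) \<Rightarrow> ('k ^ 'n) set \<Rightarrow> bool" where
  "findependent emb B \<equiv> \<not> module.dependent (fscale emb) B"

abbreviation fdim :: "('f::field \<Rightarrow> 'k::field) \<Rightarrow> ('k ^ 'n) set \<Rightarrow> nat" where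
  "fdim emb \<equiv> vector_space.dim (fscale emb)"


text \<open>
  A projective point is the one-dimensional vector subspace representing it.  A projective
  subspace of dimension \<open>d\<close> is given by the underlying vector subspace, of dimension \<open>d + 1\<close>;
  its set of points is \<open>kpoints\<close> of it (over \<open>'k\<close>) or \<open>fpoints emb\<close> of it (over \<open>'f\<close>).
  For an \<open>'f\<close>-subspace \<open>U\<close>, \<open>kpoints U\<close> is the set of the \<open>'k\<close>-points spanned by the nonzero
  vectors of \<open>U\<close>.
\<close>

definition kpoints :: "('k::field ^ 'n) set \<Rightarrow> ('k ^ 'n) set set" where
  "kpoints U = {vec.span {u} | u. u \<in> U \<and> u \<noteq> 0}"

definition fpoints :: "('f::field \<Rightarrow> 'k::field) \<Rightarrow> ('k ^ 'n) set \<Rightarrow> ('k ^ 'n) set set" where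
  "fpoints emb U = {fspan emb {u} | u. u \<in> U \<and> u \<noteq> 0}"

text \<open>The canonical subgeometry defined by \<open>W\<close> is \<open>kpoints W\<close>.\<close>

definition canonical_subgeometry_space ::
    "('f::field \<Rightarrow> 'k::field) \<Rightarrow> ('k ^ 'n) set \<Rightarrow> bool" where
  "canonical_subgeometry_space emb W \<longleftrightarrow>
     fsubspace emb W \<and> fdim emb W = CARD('n) \<and> vec.span W = UNIV"

text \<open>
  Below \<open>G\<close> and \<open>M\<close> are the vector subspaces of the centre and of the line \<open>\<ell>\<^sub>0\<close>.
\<close>

definition proj_from :: "('k::field ^ 'n) set \<Rightarrow> ('k ^ 'n) set \<Rightarrow> ('k ^ 'n) set \<Rightarrow> ('k ^ 'n) set" where
  "proj_from G M P = vec.span (G \<union> P) \<inter> M"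

definition proj_preimage ::
    "('k::field ^ 'n) set \<Rightarrow> ('k ^ 'n) set \<Rightarrow> ('k ^ 'n) set set \<Rightarrow> ('k ^ 'n) set set" where
  "proj_preimage G M r = {P \<in> kpoints UNIV. P \<notin> kpoints G \<and> proj_from G M P \<in> r}"

definition scattered_linear_set ::
    "('f::field \<Rightarrow> 'k::field) \<Rightarrow> nat \<Rightarrow> ('k ^ 'n) set \<Rightarrow> ('k ^ 'n) set set \<Rightarrow> bool" where
  "scattered_linear_set emb n M L \<longleftrightarrow>
     (\<exists>U. fsubspace emb U \<and> U \<subseteq> M \<and> fdim emb U = n \<and>
          L = {X \<in> kpoints UNIV. X \<inter> U \<noteq> {0}}) \<and>
     card L = (CARD('f) ^ n - 1) div (CARD('f) - 1)"

text \<open>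
  Linear isomorphisms from \<open>'k ^ 2\<close> onto \<open>M\<close>; they induce the projectivities from the standard
  projective line onto the line given by \<open>M\<close>.
\<close>

definition line_iso :: "('k::field ^ 2 \<Rightarrow> 'k ^ 'n) \<Rightarrow> ('k ^ 'n) set \<Rightarrow> bool" where
  "line_iso \<phi> M \<longleftrightarrow> Vector_Spaces.linear (*s) (*s) \<phi> \<and> bij_betw \<phi> UNIV M"

definition pseudoregulus_type ::
    "nat \<Rightarrow> ('k::field ^ 'n) set \<Rightarrow> ('k ^ 'n) set set \<Rightarrow> bool" where
  "pseudoregulus_type q M L \<longleftrightarrow>
     (\<exists>\<phi>. line_iso \<phi> M \<and> L = (`) \<phi> ` {vec.span {vector [l, l ^ q]} | l. l \<noteq> 0})"

definition subline ::
    "('f::field \<Rightarrow> 'k::field) \<Rightarrow> ('k ^ 'n) set \<Rightarrow> ('k ^ 'n) set set \<Rightarrow> bool" where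
  "subline emb M r \<longleftrightarrow>
     (\<exists>\<phi>. line_iso \<phi> M \<and>
          r = (`) \<phi> ` {vec.span {vector [emb a, emb b]} | a b. (a, b) \<noteq> (0, 0)})"


text \<open>
  Coordinate vectors over \<open>'f\<close>, indexed by \<open>0, \<dots>, n\<close>, of the points of the standard normal
  rational curve of order \<open>n\<close>.
\<close>

definition standard_nrc :: "nat \<Rightarrow> (nat \<Rightarrow> 'f::field) set" where
  "standard_nrc n = {(\<lambda>i. l ^ i) | l. True} \<union> {(\<lambda>i. if i = n then 1 else 0)}"

text \<open>
  \<open>C\<close> is a normal rational curve of order \<open>n\<close> in the subspace \<open>kpoints S\<close> of a canonical
  subgeometry, \<open>S\<close> being an \<open>'f\<close>-vector space of dimension \<open>n + 1\<close>.  A projectivity from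
  \<open>PG(n, q)\<close> onto this subspace is induced by an isomorphism of \<open>'f\<close>-vector spaces onto \<open>S\<close>, that
  is, by the basis \<open>w\<^sub>0, \<dots>, w\<^sub>n\<close> of \<open>S\<close> which is the image of the standard basis.
\<close>

definition normal_rational_curve ::
    "('f::field \<Rightarrow> 'k::field) \<Rightarrow> nat \<Rightarrow> ('k ^ 'n) set \<Rightarrow> ('k ^ 'n) set set \<Rightarrow> bool" where
  "normal_rational_curve emb n S C \<longleftrightarrow>
     (\<exists>w. inj_on w {..n} \<and> findependent emb (w ` {..n}) \<and> fspan emb (w ` {..n}) = S \<and>
          C = {vec.span {\<Sum>i\<le>n. fscale emb (c i) (w i)} | c. c \<in> standard_nrc n})"

text \<open>\<open>C\<close> is a normal rational curve of order \<open>n\<close> in some \<open>n\<close>-subspace of \<open>kpoints W\<close>.\<close>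

definition nrc_in_subgeometry ::
    "('f::field \<Rightarrow> 'k::field) \<Rightarrow> ('k ^ 'n) set \<Rightarrow> nat \<Rightarrow> ('k ^ 'n) set set \<Rightarrow> bool" where
  "nrc_in_subgeometry emb W n C \<longleftrightarrow>
     (\<exists>S. fsubspace emb S \<and> S \<subseteq> W \<and> fdim emb S = n + 1 \<and> normal_rational_curve emb n S C)"


text \<open>Coordinates \<open>X\<^sub>1, \<dots>, X\<^sub>t\<close> are those with respect to a basis \<open>e 1, \<dots>, e t\<close>.\<close>

definition coordinate_basis :: "(nat \<Rightarrow> 'k::field ^ 'n) \<Rightarrow> bool" where
  "coordinate_basis e \<longleftrightarrow>
     inj_on e {1..CARD('n)} \<and> vec.independent (e ` {1..CARD('n)}) \<and>
     vec.span (e ` {1..CARD('n)}) = UNIV"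

definition from_coords :: "(nat \<Rightarrow> 'k::field ^ 'n) \<Rightarrow> (nat \<Rightarrow> 'k) \<Rightarrow> 'k ^ 'n" where
  "from_coords e x = (\<Sum>i = 1..CARD('n). x i *s e i)"

definition frob :: "nat \<Rightarrow> nat \<Rightarrow> 'k::field \<Rightarrow> 'k" where
  "frob q \<nu> x = x ^ (q ^ \<nu>)"

text \<open>The point with coordinates \<open>(x\<^sub>t\<^sub>-\<^sub>1, x\<^sub>t)\<close> on the line with equations
  \<open>X\<^sub>1 = \<dots> = X\<^sub>t\<^sub>-\<^sub>2 = 0\<close>.\<close>

definition line_coords :: "(nat \<Rightarrow> 'k::field ^ 'n) \<Rightarrow> 'k ^ 2 \<Rightarrow> 'k ^ 'n" where
  "line_coords e v = v $ 1 *s e (CARD('n) - 1) + v $ 2 *s e (CARD('n))"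

definition standard_position ::
    "nat \<Rightarrow> nat \<Rightarrow> (nat \<Rightarrow> 'k::field ^ 'n) \<Rightarrow> ('k ^ 'n) set set \<Rightarrow>
     ('k ^ 'n) set \<Rightarrow> ('k ^ 'n) set \<Rightarrow> bool" where
  "standard_position q \<nu> e \<Sigma> G M \<longleftrightarrow>
     coordinate_basis e \<and>
     \<Sigma> = {vec.span {from_coords e (\<lambda>i. (frob q \<nu> ^^ (i - 1)) l)} | l. l \<noteq> 0} \<and>
     G = {from_coords e x | x. x (CARD('n) - 1) = 0 \<and> x (CARD('n)) = 0} \<and>
     M = {from_coords e x | x. \<forall>i\<in>{1..CARD('n) - 2}. x i = 0}"


definition field_reduction ::
    "('f::field \<Rightarrow> 'k::field) \<Rightarrow> 'k \<Rightarrow> 'k \<Rightarrow> ('k ^ 2) set set" where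
  "field_reduction emb a b = {fspan emb {vector [z * a, z * b]} | z. z \<noteq> 0}"

text \<open>
  \<open>T\<close> is the vector space of a line of \<open>PG(2t - 1, q)\<close> which is transversal to the regulus of
  all field reductions of points of \<open>r\<close>; here \<open>r\<close> is a set of points of the standard line.
\<close>

definition transversal_line ::
    "('f::field \<Rightarrow> 'k::field) \<Rightarrow> ('k ^ 2) set set \<Rightarrow> ('k ^ 2) set \<Rightarrow> bool" where
  "transversal_line emb r T \<longleftrightarrow>
     fsubspace emb T \<and> fdim emb T = 2 \<and>
     (\<forall>a b. (a, b) \<noteq> (0, 0) \<and> vec.span {vector [a, b]} \<in> r \<longrightarrow>
            fpoints emb T \<inter> field_reduction emb a b \<noteq> {})"

definition norm_q :: "nat \<Rightarrow> nat \<Rightarrow> 'k::field \<Rightarrow> 'k" where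
  "norm_q q t k = k ^ ((q ^ t - 1) div (q - 1))"

definition S_set :: "('f::field \<Rightarrow> 'k::field) \<Rightarrow> nat \<Rightarrow> 'k \<Rightarrow> ('k ^ 2) set set" where
  "S_set emb h k = {fspan emb {vector [z, k * z ^ (CARD('f) ^ h)]} | z. z \<noteq> 0}"

definition S_family :: "('f::field \<Rightarrow> 'k::field) \<Rightarrow> nat \<Rightarrow> nat \<Rightarrow> ('k ^ 2) set set set" where
  "S_family emb t h = {S_set emb h k | k. norm_q CARD('f) t k = 1}"

end

theory Submission
  imports Defs
begin

text \<open>
  Let \<open>p\<close> be the projection from \<open>\<Gamma>\<close>, and let \<open>\<sigma>\<close> be \<open>x \<mapsto> x\<close> raised to the power \<open>q\<^sup>s\<close>.  Comparing
  \<open>p(W)\<close> with the normal form of the linear set gives a map on the large field which is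
  linear over the ground field and preserves the norm; such a map is \<open>x \<mapsto> a x\<^sup>\<sigma>\<close>, so that \<open>W\<close> is parametrised by \<open>x\<close> with \<open>p(w x) = \<psi>(x, x\<^sup>\<sigma>)\<close>.
  Both this and the description of the sublines rest on the following remark: if \<open>a + \<lambda> b\<close> and
  \<open>c + \<lambda> d\<close> have the same norm for all \<open>\<lambda>\<close> in the ground field, and so do \<open>b\<close> and \<open>d\<close>, then two
  polynomials of degree \<open>t \<le> q\<close> in \<open>\<lambda>\<close> coincide, and comparing their roots shows that \<open>c / d\<close> is a
  conjugate of \<open>a / b\<close>.

  Hence the points of \<open>r\<close> are spanned by \<open>(z, k z\<^sup>\<tau>)\<close>, where \<open>k\<close> has norm 1, \<open>z\<close> runs through the nonzero
  elements of the span of \<open>a\<close> and \<open>b\<close>, and \<open>\<tau>\<close> is a power of the Frobenius map.  With \<open>\<alpha> = a / b\<close> of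
  degree \<open>m\<close> over the ground field, \<open>\<tau>\<close> can be replaced by \<open>\<sigma>\<^sup>n\<close> with \<open>1 \<le> n < m\<close>, and Hilbert 90 gives
  \<open>k = \<kappa>\<^sup>\<sigma> / \<kappa>\<close>.  Then \<open>(z, k z\<^sup>\<tau>)\<close> is proportional to \<open>(x, x\<^sup>\<sigma>)\<close> for the product \<open>x\<close> of \<open>\<kappa>\<close> and the
  conjugates \<open>z, z\<^sup>\<sigma>, \<dots>\<close> (\<open>n\<close> factors).  For \<open>z = a + \<lambda> b\<close> this is a polynomial of degree \<open>n\<close> in \<open>\<lambda>\<close>,
  whose coefficients are linearly independent over the ground field.
\<close>

section \<open>Finite fields\<close>

text \<open>Multiplication by a nonzero \<open>a\<close> permutes the nonzero elements, so comparing
  their products gives \<open>a ^ (CARD('f) - 1) = 1\<close>.\<close>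

lemma power_card_eq_same:
  fixes a :: "'f::field"
  assumes fin: "finite (UNIV :: 'f set)"
  shows "a ^ CARD('f) = a"
proof (cases "a = 0")
  case True
  then show ?thesis using fin by (simp add: card_gt_0_iff)
next
  case False
  have "(\<Prod>y\<in>UNIV - {0}. a * y) = (\<Prod>y\<in>UNIV - {0}. y)"
    by (rule prod.reindex_bij_witness[of _ "\<lambda>y. y / a" "\<lambda>y. a * y"]) (use False in auto)
  then have "a ^ card (UNIV - {0 :: 'f}) * \<Prod>(UNIV - {0}) = \<Prod>(UNIV - {0 :: 'f})"
    by (simp add: prod.distrib)
  moreover have "\<Prod>(UNIV - {0 :: 'f}) \<noteq> 0"
    using fin by simp
  ultimately have "a ^ (CARD('f) - 1) = 1"
    using fin by (simp add: card_Diff_singleton)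
  then have "a * a ^ (CARD('f) - 1) = a" by simp
  moreover have "CARD('f) > 0" using fin by (simp add: card_gt_0_iff)
  ultimately show ?thesis
    using power_Suc[of a "CARD('f) - 1"] by simp
qed

lemma degree_monom_diff:
  fixes p :: "'a::comm_ring_1 poly"
  assumes "degree p < n"
  shows "degree (Polynomial.monom 1 n - p) = n"
  using degree_add_eq_left[of "- p" "Polynomial.monom 1 n"] assms
  by (simp add: degree_monom_eq)

lemma card_fibers:
  assumes "finite S" and "\<And>y. y \<in> f ` S \<Longrightarrow> card {x\<in>S. f x = y} = c"
  shows "card S = c * card (f ` S)"
proof -
  have "card S = card (\<Union>y\<in>f ` S. {x\<in>S. f x = y})"
    by (rule arg_cong[of _ _ card]) auto
  also have "\<dots> = (\<Sum>y\<in>f ` S. card {x\<in>S. f x = y})"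
    by (rule card_UN_disjoint) (use assms(1) in auto)
  also have "\<dots> = (\<Sum>y\<in>f ` S. c)"
    by (rule sum.cong) (use assms(2) in auto)
  finally show ?thesis by simp
qed

section \<open>Extensions of finite fields and powers of the Frobenius map\<close>

locale finite_field_extension =
  fixes emb :: "'f::field \<Rightarrow> 'k::field" and q t :: nat
  assumes card_f: "CARD('f) = q" and card_k: "CARD('k) = q ^ t"
    and emb: "field_embedding emb" and q_pos: "q > 0" and t_pos: "t > 0"
begin

lemma finite_f: "finite (UNIV :: 'f set)"
  using card_f q_pos card_ge_0_finite by metis

lemma finite_k: "finite (UNIV :: 'k set)"
  using card_k q_pos card_ge_0_finite zero_less_power by metis

lemma finite_kset [simp]: "finite (S :: 'k set)"
  using finite_k by (rule rev_finite_subset) simp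

lemma finite_fset [simp]: "finite (S :: 'f set)"
  using finite_f by (rule rev_finite_subset) simp

lemma q_gt_1: "q > 1"
proof -
  have "card {0, 1 :: 'f} \<le> q"
    unfolding card_f[symmetric] by (rule card_mono) simp_all
  then show ?thesis by simp
qed

lemma emb_1 [simp]: "emb 1 = 1"
  and emb_add: "emb (x + y) = emb x + emb y"
  and emb_mult: "emb (x * y) = emb x * emb y"
  using emb by (auto simp: field_embedding_def)

lemma emb_0 [simp]: "emb 0 = 0"
  using emb_add[of 0 0] by (metis add.right_neutral add_cancel_left_right)

lemma emb_minus: "emb (- x) = - emb x"
  using emb_add[of x "- x"] by (simp add: eq_neg_iff_add_eq_0 add.commute)

lemma emb_diff: "emb (x - y) = emb x - emb y"
  using emb_add[of x "- y"] by (simp add: emb_minus)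

lemma emb_eq_0 [simp]: "emb x = 0 \<longleftrightarrow> x = 0"
proof
  assume "emb x = 0"
  show "x = 0"
  proof (rule ccontr)
    assume "x \<noteq> 0"
    then have "emb x * emb (inverse x) = 1"
      by (simp flip: emb_mult)
    then show False using \<open>emb x = 0\<close> by simp
  qed
qed simp

lemma emb_eq_iff [simp]: "emb x = emb y \<longleftrightarrow> x = y"
  using emb_eq_0[of "x - y"] by (simp add: emb_diff)

lemma inj_emb: "inj emb"
  by (simp add: inj_on_def)

lemma emb_divide: "emb (x / y) = emb x / emb y"
proof (cases "y = 0")
  case False
  then have "emb (x / y) * emb y = emb x"
    by (simp flip: emb_mult)
  then show ?thesis
    using False by (simp add: nonzero_eq_divide_eq)
qed simp

lemma emb_power: "emb (x ^ n) = emb x ^ n"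
  by (induction n) (simp_all add: emb_mult)

lemma card_range_emb: "card (range emb) = q"
  using card_image[OF inj_emb] card_f by simp

text \<open>The polynomial X^q - X vanishes at the \<open>q\<close> elements of
  \<open>range emb\<close> and cannot have further roots.\<close>

lemma power_eq_self_iff: "x ^ q = x \<longleftrightarrow> x \<in> range emb"
proof -
  define p :: "'k poly" where "p = Polynomial.monom 1 q - [:0, 1:]"
  have deg: "degree p = q"
    unfolding p_def using q_gt_1
    by (intro degree_monom_diff) (auto simp: degree_monom_eq)
  have poly_p: "poly p x = x ^ q - x" for x
    by (simp add: p_def poly_monom)
  have "range emb \<subseteq> {x. poly p x = 0}"
    by (auto simp: poly_p power_card_eq_same[OF finite_f, unfolded card_f] simp flip: emb_power)
  moreover have "card {x. poly p x = 0} \<le> q"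
    using card_poly_roots_bound[of p] deg q_pos by force
  ultimately have "range emb = {x. poly p x = 0}"
    by (metis card_range_emb card_seteq finite_kset)
  then show ?thesis by (auto simp: poly_p)
qed

text \<open>Two monic polynomials of degree \<open>q\<close> that agree at \<open>q\<close> points
  coincide; both sides vanish on the ground field.\<close>

lemma power_q_minus_self: "x ^ q - x = (\<Prod>c\<in>UNIV. x - emb c)"
proof -
  define p :: "'k poly" where "p = Polynomial.monom 1 q - [:0, 1:]"
  define r :: "'k poly" where "r = (\<Prod>c\<in>UNIV. [:- emb c, 1:])"
  have deg: "degree r = q"
    using card_f by (simp add: r_def degree_prod_eq_sum_degree)
  have "p = r"
  proof (rule poly_eqI_degree_lead_coeff[where A = "range emb" and n = q])
    show "poly.coeff p q = poly.coeff r q"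
      using lead_coeff_prod[of "\<lambda>c. [:- emb c, 1:]" UNIV] q_gt_1 deg
      by (auto simp: p_def r_def coeff_pCons split: nat.splits)
    show "degree p \<le> q" unfolding p_def
      by (rule degree_diff_le) (use q_gt_1 in \<open>auto simp: degree_monom_eq\<close>)
    fix z assume "z \<in> range emb"
    then show "poly p z = poly r z"
      using power_eq_self_iff[of z]
      by (auto simp: p_def r_def poly_monom poly_prod intro!: prod_zero)
  qed (use deg card_range_emb in auto)
  then have "poly p x = poly r x" by simp
  then show ?thesis by (simp add: p_def r_def poly_monom poly_prod)
qed

text \<open>Both sides are monic polynomials of degree \<open>q\<close> in \<open>x\<close>, and for \<open>x\<close> in the ground field
  they agree because \<open>X\<^sup>q - X\<close> is invariant under translations by the ground field.\<close>

lemma power_q_add: "(x + y) ^ q = x ^ q + (y :: 'k) ^ q"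
proof -
  have trans: "(emb c + y) ^ q = emb c + y ^ q" for c
  proof -
    have "(\<Prod>d\<in>UNIV. emb c + y - emb d) = (\<Prod>d\<in>UNIV. y - emb d)"
      by (rule prod.reindex_bij_witness[of _ "\<lambda>d. d + c" "\<lambda>d. d - c"])
         (auto simp: emb_diff emb_add)
    then have "(emb c + y) ^ q - (emb c + y) = y ^ q - y"
      by (simp only: power_q_minus_self)
    then show ?thesis by (simp add: algebra_simps)
  qed
  have "[:y, 1:] ^ q = Polynomial.monom 1 q + [:y ^ q:]"
  proof (rule poly_eqI_degree_lead_coeff[where A = "range emb" and n = q])
    show "poly.coeff ([:y, 1:] ^ q) q = poly.coeff (Polynomial.monom 1 q + [:y ^ q:]) q"
      using lead_coeff_power[of "[:y, 1:]" q] q_pos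
      by (simp add: degree_linear_power coeff_pCons split: nat.splits)
    show "degree (Polynomial.monom 1 q + [:y ^ q:]) \<le> q"
      by (rule degree_add_le) (auto simp: degree_monom_le)
    fix z assume "z \<in> range emb"
    then show "poly ([:y, 1:] ^ q) z = poly (Polynomial.monom 1 q + [:y ^ q:]) z"
      using trans power_eq_self_iff[of z] by (auto simp: poly_monom add.commute)
  qed (auto simp: card_range_emb degree_linear_power)
  then have "poly ([:y, 1:] ^ q) x = poly (Polynomial.monom 1 q + [:y ^ q:]) x" by simp
  then show ?thesis by (simp add: poly_monom add.commute)
qed

lemma frob_add: "frob q i (x + y) = frob q i x + frob q i (y :: 'k)"
  by (induction i) (simp_all add: frob_def power_mult mult.commute[of q] power_q_add)

lemma frob_mult: "frob q i (x * y) = frob q i x * frob q i (y :: 'k)"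
  by (simp add: frob_def power_mult_distrib)

lemma frob_0 [simp]: "frob q i (0 :: 'k) = 0"
  using q_pos by (simp add: frob_def)

lemma frob_1 [simp]: "frob q i (1 :: 'k) = 1"
  by (simp add: frob_def)

lemma frob_index_0 [simp]: "frob q 0 (x :: 'k) = x"
  by (simp add: frob_def)

lemma frob_minus: "frob q i (- x) = - frob q i (x :: 'k)"
  using frob_add[of i x "- x"] by (simp add: eq_neg_iff_add_eq_0 add.commute)

lemma frob_diff: "frob q i (x - y) = frob q i x - frob q i (y :: 'k)"
  using frob_add[of i x "- y"] by (simp add: frob_minus)

lemma frob_divide: "frob q i (x / y) = frob q i x / frob q i (y :: 'k)"
  by (simp add: frob_def power_divide)

lemma frob_sum: "frob q i (sum f S) = (\<Sum>x\<in>S. frob q i (f x :: 'k))"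
  by (induction S rule: infinite_finite_induct) (simp_all add: frob_add)

lemma frob_prod: "frob q i (prod f S) = (\<Prod>x\<in>S. frob q i (f x :: 'k))"
  by (simp add: frob_def prod_power_distrib)

lemma frob_eq_0 [simp]: "frob q i (x :: 'k) = 0 \<longleftrightarrow> x = 0"
  using q_pos by (simp add: frob_def)

lemma frob_eq_iff [simp]: "frob q i x = frob q i (y :: 'k) \<longleftrightarrow> x = y"
  using frob_eq_0[of i "x - y"] by (simp add: frob_diff)

lemma frob_frob: "frob q i (frob q j (x :: 'k)) = frob q (i + j) x"
  by (simp add: frob_def power_add mult.commute flip: power_mult)

lemma frob_emb [simp]: "frob q i (emb c) = emb c"
proof (induction i)
  case (Suc i)
  have "frob q (Suc i) (emb c) = frob q i (emb c) ^ q"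
    by (simp add: frob_def mult.commute flip: power_mult)
  then show ?case using Suc power_eq_self_iff[of "emb c"] by simp
qed simp

lemma frob_t [simp]: "frob q t (x :: 'k) = x"
  using power_card_eq_same[OF finite_k, of x] by (simp add: frob_def card_k)

lemma frob_mult_t [simp]: "frob q (t * j) (x :: 'k) = x"
proof (induction j)
  case (Suc j)
  have "frob q (t * Suc j) x = frob q t (frob q (t * j) x)"
    by (simp add: frob_frob)
  then show ?case using Suc by simp
qed simp

lemma bij_frob: "bij (frob q i :: 'k \<Rightarrow> 'k)"
  using finite_UNIV_inj_surj[of "frob q i :: 'k \<Rightarrow> 'k"] by (auto simp: bij_def inj_on_def)

lemma frob_fixed_multiple:
  assumes "frob q i (x :: 'k) = x"
  shows "frob q (i * j) x = x"
proof (induction j)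
  case (Suc j)
  have "frob q (i * Suc j) x = frob q i (frob q (i * j) x)"
    by (simp add: frob_frob)
  then show ?case using Suc assms by simp
qed simp

lemma frob_funpow: "(frob q i ^^ j) (x :: 'k) = frob q (i * j) x"
  by (induction j) (simp_all add: frob_frob)

text \<open>A Bezout relation \<open>i * a = j * b + 1\<close> makes \<open>x\<close> a fixed point
  of the \<open>q\<close>-th power map, hence an element of the ground field. For
  \<open>i = 0\<close> there is no such relation, but then \<open>j = 1\<close>.\<close>

lemma frob_fixed_coprime:
  assumes "coprime i j" and "frob q i x = x" and "frob q j (x :: 'k) = x"
  shows "x \<in> range emb"
proof (cases "i = 0")
  case True
  then have "j = 1" using assms(1) by simp
  then show ?thesis using assms(3) power_eq_self_iff by (simp add: frob_def)
next
  case False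
  then obtain a b where "i * a = j * b + 1"
    using bezout_nat[of i j] assms(1) by auto
  then have "frob q (1 + j * b) x = x"
    using frob_fixed_multiple[OF assms(2), of a] by (simp add: add.commute)
  then have "frob q 1 x = x"
    using frob_frob[of 1 "j * b" x] frob_fixed_multiple[OF assms(3), of b] by simp
  then show ?thesis using power_eq_self_iff by (simp add: frob_def)
qed

section \<open>The norm, and Hilbert 90 by counting\<close>

lemma norm_q_mult: "norm_q q t (x * y) = norm_q q t x * norm_q q t (y :: 'k)"
  by (simp add: norm_q_def power_mult_distrib)

lemma norm_q_divide: "norm_q q t (x / y) = norm_q q t x / norm_q q t (y :: 'k)"
  by (simp add: norm_q_def power_divide)

text \<open>The exponent in the norm is the geometric sum 1 + q + ... + q^(t-1), so the norm is the
  product of the conjugates.\<close>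

lemma norm_q_conv_prod: "norm_q q t (x :: 'k) = (\<Prod>i<t. frob q i x)"
proof -
  have "(q ^ t - 1) div (q - 1) = (\<Sum>i<t. q ^ i)"
  proof -
    have "int (q ^ t - 1) = int ((q - 1) * (\<Sum>i<t. q ^ i))"
      using q_pos power_diff_1_eq[of "int q" t] by (simp add: of_nat_diff)
    then have "q ^ t - 1 = (q - 1) * (\<Sum>i<t. q ^ i)" by (simp only: of_nat_eq_iff)
    then show ?thesis using q_gt_1 by simp
  qed
  then show ?thesis
    by (simp add: norm_q_def frob_def power_sum)
qed

lemma norm_q_eq_0 [simp]: "norm_q q t (x :: 'k) = 0 \<longleftrightarrow> x = 0"
  using t_pos by (auto simp: norm_q_conv_prod)

text \<open>The map \<open>frob q 1\<close> shifts the \<open>t\<close> conjugates cyclically,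
  because \<open>frob q t\<close> is the identity.\<close>

lemma norm_q_frob [simp]: "norm_q q t (frob q i (x :: 'k)) = norm_q q t x"
proof (induction i)
  case (Suc i)
  have "norm_q q t (frob q 1 y) = norm_q q t y" for y :: 'k
  proof (cases "y = 0")
    case False
    have "norm_q q t (frob q 1 y) * y = (\<Prod>i<Suc t. frob q i y)"
      unfolding prod.lessThan_Suc_shift by (simp add: norm_q_conv_prod frob_frob mult.commute)
    also have "\<dots> = norm_q q t y * y"
      by (simp add: norm_q_conv_prod)
    finally show ?thesis using False by simp
  qed simp
  from this[of "frob q i x"] Suc show ?case
    by (simp add: frob_frob)
qed simp

text \<open>With \<open>\<sigma> = frob q s\<close>, the fibres of \<open>x \<mapsto> x\<^sup>\<sigma>\<^sup>-\<^sup>1\<close> are the cosets of its kernel.\<close>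

lemma card_frob_ratio:
  "q ^ t - 1 = card {x :: 'k. x \<noteq> 0 \<and> frob q s x = x} * card ((\<lambda>x :: 'k. frob q s x / x) ` (- {0}))"
proof -
  have "card (- {0 :: 'k}) = q ^ t - 1"
    by (simp add: Compl_eq_Diff_UNIV card_Diff_singleton card_k)
  moreover have "card {x \<in> - {0}. frob q s x / x = y} = card {x :: 'k. x \<noteq> 0 \<and> frob q s x = x}"
    if y: "y \<in> (\<lambda>x. frob q s x / x) ` (- {0 :: 'k})" for y
  proof -
    obtain z where z: "z \<noteq> 0" "y = frob q s z / z" using y by auto
    have "bij_betw (\<lambda>x. x * z) {x. x \<noteq> 0 \<and> frob q s x = x} {x \<in> - {0}. frob q s x / x = y}"
      by (rule bij_betwI[where g = "\<lambda>x. x / z"])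
         (use z in \<open>auto simp: frob_mult frob_divide field_simps\<close>)
    then show ?thesis by (simp add: bij_betw_same_card)
  qed
  ultimately show ?thesis
    using card_fibers[of "- {0 :: 'k}" "\<lambda>x. frob q s x / x"] by simp
qed

lemma card_units_f: "card (range emb - {0}) = q - 1"
  by (subst card_Diff_singleton) (auto simp: card_range_emb image_iff intro: exI[of _ 0])

lemma card_norm_one_le: "card {k :: 'k. norm_q q t k = 1} \<le> (q ^ t - 1) div (q - 1)"
proof -
  define d where "d = (q ^ t - 1) div (q - 1)"
  have d: "d > 0"
  proof -
    have "q ^ 1 \<le> q ^ t" using q_pos t_pos by (intro power_increasing) auto
    then show ?thesis using q_gt_1 by (simp add: d_def div_greater_zero_iff)
  qed
  define p :: "'k poly" where "p = Polynomial.monom 1 d - 1"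
  have "degree p = d"
    unfolding p_def using d by (intro degree_monom_diff) simp
  then have "p \<noteq> 0" using d by auto
  from card_poly_roots_bound[OF this] \<open>degree p = d\<close> show ?thesis
    by (simp add: p_def poly_monom norm_q_def d_def)
qed

text \<open>Hilbert 90: coprimality makes the kernel the \<open>q - 1\<close> units of the ground
  field, so the image has (q^t - 1)/(q - 1) elements, and there are no more elements of norm 1 than
  that.\<close>

lemma frob_ratio_norm_one:
  assumes "coprime s t"
  shows "(\<lambda>x :: 'k. frob q s x / x) ` (- {0}) = {k. norm_q q t k = 1}"
proof (rule card_seteq)
  show "(\<lambda>x :: 'k. frob q s x / x) ` (- {0}) \<subseteq> {k. norm_q q t k = 1}"
    by (auto simp: norm_q_divide)
  have "{x :: 'k. x \<noteq> 0 \<and> frob q s x = x} = range emb - {0}"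
    using frob_fixed_coprime[OF assms _ frob_t] by auto
  then have "q ^ t - 1 = (q - 1) * card ((\<lambda>x :: 'k. frob q s x / x) ` (- {0}))"
    using card_frob_ratio[of s] card_units_f by simp
  then show "card {k :: 'k. norm_q q t k = 1} \<le> card ((\<lambda>x :: 'k. frob q s x / x) ` (- {0}))"
    using card_norm_one_le q_gt_1 by simp
qed simp

text \<open>A converse to Hilbert 90. Equality of the counts leaves only ground field elements fixed
  under \<open>frob q s\<close>. With \<open>g = gcd s t\<close>, every \<open>y ^ e\<close> below
  is fixed, being the norm of \<open>y\<close> to the field of elements fixed by
  \<open>frob q g\<close>. So it lies in the ground field, which for \<open>g > 1\<close> gives a
  polynomial too many roots.\<close>

lemma coprime_of_card_frob_ratio:
  assumes "card ((\<lambda>x :: 'k. frob q s x / x) ` (- {0})) = card {k :: 'k. norm_q q t k = 1}"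
  shows "coprime s t"
proof -
  define g where "g = gcd s t"
  define N where "N = card {k :: 'k. norm_q q t k = 1}"
  define K where "K = card {x :: 'k. x \<noteq> 0 \<and> frob q s x = x}"
  \<comment> \<open>The case \<open>s = 1\<close> of Hilbert 90 evaluates the number of elements of
    norm 1.\<close>
  have Q: "N * (q - 1) = q ^ t - 1"
  proof -
    have "{x :: 'k. x \<noteq> 0 \<and> frob q 1 x = x} = range emb - {0}"
      by (auto simp: frob_def power_eq_self_iff)
    then show ?thesis
      unfolding N_def
      using card_frob_ratio[of 1] card_units_f frob_ratio_norm_one[of 1] by (simp add: mult.commute)
  qed
  have Q_pos: "q ^ t - 1 > 0"
    using q_gt_1 t_pos one_less_power[of q t] by simp
  have "q ^ t - 1 = K * N"
    using card_frob_ratio[of s] unfolding assms N_def K_def .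
  with Q have "N * K = N * (q - 1)" by (simp only: mult.commute)
  moreover have "N \<noteq> 0" using Q Q_pos by (intro notI) simp
  ultimately have "K = q - 1" by (simp only: mult_cancel1 simp_thms)
  then have ker: "{x :: 'k. x \<noteq> 0 \<and> frob q s x = x} = range emb - {0}"
    by (intro card_seteq[symmetric]) (auto simp: card_units_f K_def)
  have "g > 0" using t_pos by (simp add: g_def)
  obtain u where u: "t = g * u" unfolding g_def using gcd_dvd2 by (metis dvdE)
  obtain v where v: "s = g * v" unfolding g_def using gcd_dvd1 by (metis dvdE)
  have fixed: "x \<in> range emb" if "frob q g x = x" for x :: 'k
  proof -
    have "frob q s x = x" using frob_fixed_multiple[OF that] v by simp
    then show ?thesis using ker by (cases "x = 0") (auto intro: range_eqI[of _ _ 0])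
  qed
  define e where "e = (\<Sum>i<u. (q ^ g) ^ i)"
  have e: "frob q g x = x" if "x = y ^ e" for x y :: 'k
  proof (cases "y = 0")
    case False
    have x: "x = (\<Prod>i<u. frob q (g * i) y)"
      unfolding that by (simp add: e_def power_sum frob_def power_mult)
    have "frob q g x * y = (\<Prod>i<Suc u. frob q (g * i) y)"
      unfolding prod.lessThan_Suc_shift by (simp add: x frob_prod frob_frob mult.commute)
    also have "\<dots> = x * frob q (g * u) y"
      by (simp add: x)
    finally show ?thesis using False by (simp flip: u)
  next
    case True
    then show ?thesis using that by (cases "e = 0") (auto simp: zero_power)
  qed
  have "g = 1"
  proof (rule ccontr)
    assume "g \<noteq> 1"
    then have "g > 1" using \<open>g > 0\<close> by simp
    have all: "(y :: 'k) ^ (e * q) = y ^ e" for y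
      using fixed[OF e[OF refl], of y] power_eq_self_iff[of "y ^ e"] by (simp add: power_mult)
    have qt: "q ^ t - 1 = (q ^ g - 1) * e"
    proof -
      have "int (q ^ t - 1) = int ((q ^ g - 1) * e)"
        using q_pos power_diff_1_eq[of "int (q ^ g)" u] u
        by (simp add: of_nat_diff e_def power_mult)
      then show ?thesis by (simp only: of_nat_eq_iff)
    qed
    have "e > 0" using qt Q_pos by (metis mult_0_right not_gr_zero)
    \<comment> \<open>All \<open>q ^ t\<close> elements are roots of this polynomial, while
      \<open>g > 1\<close> bounds its degree \<open>e * q\<close> by
      \<open>q ^ t - 1\<close>.\<close>
    define p :: "'k poly" where "p = Polynomial.monom 1 (e * q) - Polynomial.monom 1 e"
    have deg: "degree p = e * q"
      unfolding p_def using q_gt_1 \<open>e > 0\<close>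
      by (intro degree_monom_diff) (auto simp: degree_monom_eq)
    then have "p \<noteq> 0" using \<open>e > 0\<close> q_pos by auto
    have "CARD('k) \<le> e * q"
      using card_poly_roots_bound[OF \<open>p \<noteq> 0\<close>] all deg by (simp add: p_def poly_monom)
    moreover have "e * q \<le> e * (q ^ g - 1)"
    proof -
      have "q * 2 \<le> q * q ^ (g - 1)"
      proof -
        have "2 ^ 1 \<le> q ^ 1" using q_gt_1 by simp
        also have "\<dots> \<le> q ^ (g - 1)" using \<open>g > 1\<close> q_gt_1 by (intro power_increasing) auto
        finally show ?thesis by simp
      qed
      also have "\<dots> = q ^ g" using \<open>g > 1\<close> by (simp flip: power_Suc)
      finally have "q \<le> q ^ g - 1" using q_gt_1 by linarith
      then show ?thesis by (rule mult_le_mono2)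
    qed
    ultimately have "q ^ t \<le> q ^ t - 1"
      unfolding qt card_k by (simp only: mult.commute[of "q ^ g - 1"])
    then show False using Q_pos by linarith
  qed
  then show ?thesis unfolding g_def by (simp only: coprime_iff_gcd_eq_1)
qed

end

text \<open>Coefficient functions that are extensional on \<open>B\<close> correspond one to one to
  the vectors of the span.\<close>

lemma (in vector_space) card_span_independent:
  assumes "finite B" and "independent B"
  shows "card (span B) = CARD('a) ^ card B"
proof -
  let ?c = "\<lambda>u. \<Sum>v\<in>B. scale (u v) v"
  have "span B = ?c ` (B \<rightarrow>\<^sub>E UNIV)"
  proof -
    have "?c u \<in> ?c ` (B \<rightarrow>\<^sub>E UNIV)" for u
      by (rule image_eqI[where x = "restrict u B"]) (auto intro!: sum.cong)
    then show ?thesis unfolding span_finite[OF assms(1)] by auto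
  qed
  moreover have "inj_on ?c (B \<rightarrow>\<^sub>E UNIV)"
  proof (rule inj_onI)
    fix u u' assume u: "u \<in> B \<rightarrow>\<^sub>E UNIV" "u' \<in> B \<rightarrow>\<^sub>E UNIV" and eq: "?c u = ?c u'"
    have "(\<Sum>v\<in>B. scale (u v - u' v) v) = 0"
      using eq by (simp add: scale_left_diff_distrib sum_subtractf)
    then have "u v - u' v = 0" if "v \<in> B" for v
      using independentD[OF assms(2,1) subset_refl, of "\<lambda>v. u v - u' v"] that by blast
    then show "u = u'"
      using u by (intro PiE_ext[OF u]) auto
  qed
  ultimately show ?thesis
    using assms(1) by (simp add: card_image card_PiE)
qed

section \<open>Elements and linear maps determined by their norms\<close>

context finite_field_extension
begin

text \<open>After division by \<open>b\<close> and \<open>d\<close> the norms are values of two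
  monic polynomials of degree \<open>t\<close>, whose roots are the negated conjugates of
  \<open>a / b\<close> and of \<open>c / d\<close>. As \<open>t \<le> q\<close>, agreement on the
  ground field makes them equal, so they share the root \<open>- (c / d)\<close>.\<close>

lemma norm_eq_imp_conjugate:
  assumes "t \<le> q" "b \<noteq> 0" "d \<noteq> 0" "norm_q q t b = norm_q q t d"
    and norm: "\<And>l. norm_q q t (a + emb l * b) = norm_q q t (c + emb l * d)"
  shows "\<exists>h<t. c / d = frob q h (a / b)"
proof -
  define P where "P x = (\<Prod>i<t. [:frob q i x, 1:])" for x :: 'k
  have deg: "degree (P x) = t" for x
    by (simp add: P_def degree_prod_eq_sum_degree)
  have monic: "poly.coeff (P x) t = 1" for x
    using lead_coeff_prod[of "\<lambda>i. [:frob q i x, 1:]" "{..<t}"] deg[of x]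
    by (simp add: P_def)
  have "poly (P (a / b)) z = poly (P (c / d)) z" if z: "z \<in> range emb" for z
  proof -
    obtain l where l: "z = emb l" using z by blast
    have eval: "poly (P x) z = norm_q q t (x + z)" for x
      by (simp add: P_def poly_prod norm_q_conv_prod frob_add l)
    have "a / b + z = (a + emb l * b) / b" "c / d + z = (c + emb l * d) / d"
      using assms(2,3) by (simp_all add: l field_simps)
    then show ?thesis
      using norm[of l] assms(4) by (simp add: eval norm_q_divide)
  qed
  then have "P (a / b) = P (c / d)"
    by (intro poly_eqI_degree_lead_coeff[where A = "range emb" and n = t])
       (use assms(1) in \<open>auto simp: deg monic card_range_emb\<close>)
  moreover have "poly (P (c / d)) (- (c / d)) = 0"
    using t_pos by (auto simp: P_def poly_prod intro!: bexI[of _ 0])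
  ultimately have "poly (P (a / b)) (- (c / d)) = 0"
    by simp
  then have "\<exists>i<t. frob q i (a / b) - c / d = 0"
    by (auto simp: P_def poly_prod)
  then show ?thesis by auto
qed

text \<open>If \<open>x\<close> lies only in \<open>U i\<close> and \<open>y\<close> does not lie in \<open>U i\<close>, then two of the \<open>q\<close> vectors \<open>y + l x\<close>
  share one of the remaining subspaces, which then contains \<open>x\<close>.\<close>

lemma subspace_cover_contains_UNIV:
  fixes U :: "'i \<Rightarrow> 'k set"
  assumes "finite I" "card I \<le> q" "(\<Union>i\<in>I. U i) = UNIV"
    and "\<And>i x y. i \<in> I \<Longrightarrow> x \<in> U i \<Longrightarrow> y \<in> U i \<Longrightarrow> x - y \<in> U i"
    and "\<And>i c x. i \<in> I \<Longrightarrow> x \<in> U i \<Longrightarrow> emb c * x \<in> U i"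
  shows "\<exists>i\<in>I. U i = UNIV"
  using assms
proof (induction I rule: finite_induct)
  case (insert i J)
  show ?case
  proof (cases "U i = UNIV \<or> (\<Union>j\<in>J. U j) = UNIV")
    case True
    then show ?thesis using insert by auto
  next
    case False
    then obtain x y where y: "y \<notin> U i" and x: "x \<notin> (\<Union>j\<in>J. U j)" by blast
    then have xi: "x \<in> U i" using insert.prems(2) by auto
    have "\<exists>j\<in>J. y + emb l * x \<in> U j" for l
    proof -
      have "y + emb l * x \<notin> U i"
        using insert.prems(3)[of i "y + emb l * x" "emb l * x"] insert.prems(4)[of i x l] xi y by auto
      then show ?thesis using insert.prems(2) by blast
    qed
    then obtain j where j: "\<And>l. j l \<in> J" "\<And>l. y + emb l * x \<in> U (j l)" by metis
    have "card (j ` UNIV) < CARD('f)"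
    proof -
      have "card (j ` UNIV) \<le> card J" using j(1) insert.hyps(1) by (intro card_mono) auto
      then show ?thesis using insert.prems(1) insert.hyps card_f by simp
    qed
    then have "\<not> inj j" by (rule pigeonhole)
    then obtain l l' where l: "l \<noteq> l'" "j l = j l'" by (auto simp: inj_on_def)
    have "(y + emb l * x) - (y + emb l' * x) \<in> U (j l)"
      using j(2)[of l'] l(2) by (intro insert.prems(3) insertI2 j) simp
    then have "emb (inverse (l - l')) * ((y + emb l * x) - (y + emb l' * x)) \<in> U (j l)"
      using insert.prems(4)[of "j l"] j(1) by simp
    moreover have "emb (inverse (l - l')) * ((y + emb l * x) - (y + emb l' * x)) = x"
    proof -
      have "(y + emb l * x) - (y + emb l' * x) = emb (l - l') * x"
        by (simp add: emb_diff algebra_simps)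
      moreover have "emb (inverse (l - l')) * emb (l - l') = 1"
        using l(1) by (simp flip: emb_mult)
      ultimately show ?thesis by (simp flip: mult.assoc)
    qed
    ultimately show ?thesis using x j(1) by auto
  qed
qed simp

text \<open>By the norm comparison \<open>f x / f 1\<close> is a conjugate of \<open>x\<close>, but
  the exponent may depend on \<open>x\<close>. The sets \<open>U h\<close> where a given exponent
  works are subspaces over the ground field, and \<open>t \<le> q\<close> of them cover everything
  only if one of them is everything.\<close>

lemma norm_preserving_linear:
  fixes f :: "'k \<Rightarrow> 'k"
  assumes "t \<le> q" and add: "\<And>x y. f (x + y) = f x + f y"
    and scale: "\<And>c x. f (emb c * x) = emb c * f x"
    and norm: "\<And>x. norm_q q t (f x) = norm_q q t x"
  shows "\<exists>s a. norm_q q t a = 1 \<and> (\<forall>x. f x = a * frob q s x)"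
proof -
  have n1: "norm_q q t (f 1) = 1" by (simp add: norm) (simp add: norm_q_def)
  then have "f 1 \<noteq> 0" by (metis norm_q_eq_0 zero_neq_one)
  define U where "U h = {x. f x = f 1 * frob q h x}" for h
  have diff: "f (x - y) = f x - f y" for x y
    using add[of "x - y" y] by simp
  have "\<exists>h<t. f x = f 1 * frob q h x" for x
  proof -
    have "\<exists>h<t. f x / f 1 = frob q h (x / 1)"
    proof (rule norm_eq_imp_conjugate)
      fix l
      show "norm_q q t (x + emb l * 1) = norm_q q t (f x + emb l * f 1)"
        using norm[of "x + emb l * 1"] by (simp add: add scale[of l 1, simplified])
    qed (use assms(1) norm \<open>f 1 \<noteq> 0\<close> in auto)
    then show ?thesis using \<open>f 1 \<noteq> 0\<close> by (auto simp: field_simps)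
  qed
  then have "(\<Union>h<t. U h) = UNIV" by (auto simp: U_def)
  then have "\<exists>h\<in>{..<t}. U h = UNIV"
    by (intro subspace_cover_contains_UNIV)
       (use assms(1) in \<open>auto simp: U_def diff scale frob_diff frob_mult right_diff_distrib mult.left_commute\<close>)
  then show ?thesis using n1 by (auto simp: U_def)
qed

section \<open>Independence of the coefficients of a product of conjugates\<close>

lemma coeff_prod_frob:
  "poly.coeff (\<Prod>j<n::nat. [:frob q s (\<beta> j), 1:]) i = frob q s (poly.coeff (\<Prod>j<n. [:\<beta> j, 1 :: 'k:]) i)"
  by (induction n arbitrary: i)
     (simp_all add: mult.commute[of _ "[:_, 1:]"] coeff_pCons frob_add frob_mult split: nat.splits)

text \<open>Extend a linear relation between the coefficients of \<open>C n\<close> to the functional \<open>A\<close> on polynomials,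
  which commutes with \<open>\<sigma> = frob q s\<close>.  Since \<open>C (n + 1) - \<sigma> (C (n + 1))\<close> is a nonzero multiple of
  \<open>\<sigma> (C n)\<close>, the functional vanishes on all the monic polynomials \<open>C j\<close>, \<open>j \<le> n\<close>.\<close>

lemma coeffs_conjugate_prod_independent:
  fixes \<alpha> :: 'k
  assumes moved: "\<And>j. 1 \<le> j \<Longrightarrow> j \<le> n \<Longrightarrow> frob q (s * j) \<alpha> \<noteq> \<alpha>"
    and zero: "(\<Sum>i\<le>n. emb (a i) * poly.coeff (\<Prod>j<n. [:frob q (s * j) \<alpha>, 1:]) i) = 0"
    and "i \<le> n"
  shows "a i = 0"
proof -
  define C where "C m = (\<Prod>j<m. [:frob q (s * j) \<alpha>, 1:])" for m
  define C' where "C' m = (\<Prod>j<m. [:frob q (s * Suc j) \<alpha>, 1:])" for m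
  define A where "A p = (\<Sum>i\<le>n. emb (a i) * poly.coeff p i)" for p
  have C': "poly.coeff (C' m) i = frob q s (poly.coeff (C m) i)" for m i
    unfolding C'_def C_def coeff_prod_frob[symmetric] by (simp add: frob_frob)
  have A_C': "A (C' m) = frob q s (A (C m))" for m
    by (simp add: A_def C' frob_sum frob_mult)
  have deg: "degree (C m) = m" for m
    by (simp add: C_def degree_prod_eq_sum_degree)
  have monic: "poly.coeff (C m) m = 1" for m
    using lead_coeff_prod[of "\<lambda>j. [:frob q (s * j) \<alpha>, 1:]" "{..<m}"] deg[of m]
    by (simp add: C_def)
  have step: "A (C m) = 0" if "A (C (Suc m)) = 0" "Suc m \<le> n" for m
  proof -
    have 1: "C (Suc m) = [:\<alpha>, 1:] * C' m"
      unfolding C_def C'_def prod.lessThan_Suc_shift by simp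
    have 2: "C' (Suc m) = [:frob q (s * Suc m) \<alpha>, 1:] * C' m"
      by (simp add: C'_def mult.commute)
    have "C (Suc m) - C' (Suc m) = Polynomial.smult (\<alpha> - frob q (s * Suc m) \<alpha>) (C' m)"
      unfolding 1 2 by (simp add: smult_diff_left)
    then have "(\<alpha> - frob q (s * Suc m) \<alpha>) * A (C' m) = A (C (Suc m) - C' (Suc m))"
      by (simp add: A_def sum_distrib_left mult_ac)
    also have "\<dots> = A (C (Suc m)) - A (C' (Suc m))"
      by (simp add: A_def algebra_simps sum_subtractf)
    also have "\<dots> = 0" using that by (simp add: A_C')
    finally show ?thesis using moved[of "Suc m"] that(2) by (simp add: A_C')
  qed
  have A0: "A (C m) = 0" if "m \<le> n" for m
    using that
  proof (induction m rule: inc_induct)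
    case base
    show ?case using zero by (simp add: A_def C_def)
  next
    case (step m)
    then show ?case using \<open>\<And>m. A (C (Suc m)) = 0 \<Longrightarrow> Suc m \<le> n \<Longrightarrow> A (C m) = 0\<close> by simp
  qed
  show ?thesis using \<open>i \<le> n\<close>
  proof (induction i rule: less_induct)
    case (less i)
    \<comment> \<open>As \<open>C i\<close> is monic of degree \<open>i\<close> and the earlier
      \<open>a k\<close> vanish, the functional takes the value \<open>emb (a i)\<close> on
      it.\<close>
    have "A (C i) = (\<Sum>k\<in>{i}. emb (a k) * poly.coeff (C i) k)"
      unfolding A_def
    proof (rule sum.mono_neutral_right)
      show "\<forall>k\<in>{..n} - {i}. emb (a k) * poly.coeff (C i) k = 0"
      proof
        fix k assume k: "k \<in> {..n} - {i}"
        show "emb (a k) * poly.coeff (C i) k = 0"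
        proof (cases "k < i")
          case True
          then show ?thesis using less k by simp
        next
          case False
          then show ?thesis using k deg[of i] by (simp add: coeff_eq_0)
        qed
      qed
    qed (use less in auto)
    then show ?case using A0[OF less.prems] monic by simp
  qed
qed

end

text \<open>Relations indexed by \<open>I\<close> also yield injectivity: a repeated vector would
  give one with coefficients 1 and -1.\<close>

lemma (in vector_space) independent_family:
  assumes "finite I" and zero: "\<And>a i. (\<Sum>i\<in>I. scale (a i) (v i)) = 0 \<Longrightarrow> i \<in> I \<Longrightarrow> a i = 0"
  shows "inj_on v I" and "independent (v ` I)"
proof -
  show inj: "inj_on v I"
  proof (rule inj_onI, rule ccontr)
    fix i j assume ij: "i \<in> I" "j \<in> I" "v i = v j" "i \<noteq> j"
    define a :: "_ \<Rightarrow> 'a" where "a k = (if k = i then 1 else if k = j then - 1 else 0)" for k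
    have "(\<Sum>k\<in>I. scale (a k) (v k)) = (\<Sum>k\<in>{i, j}. scale (a k) (v k))"
      by (rule sum.mono_neutral_right) (use assms(1) ij in \<open>auto simp: a_def\<close>)
    also have "\<dots> = 0" using ij by (simp add: a_def)
    finally show False using zero[of a i] ij(1) by (simp add: a_def)
  qed
  show "independent (v ` I)"
  proof (rule independent_if_scalars_zero)
    fix f x assume f: "(\<Sum>x\<in>v ` I. scale (f x) x) = 0" and "x \<in> v ` I"
    then show "f x = 0"
      using zero[of "\<lambda>i. f (v i)"] by (auto simp: sum.reindex[OF inj])
  qed (use assms(1) in auto)
qed

section \<open>The curve of a subline\<close>

lemma span_singleton_scale:
  assumes "c \<noteq> 0"
  shows "vec.span {c *s x} = vec.span {x :: 'k::field ^ 'n}"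
  using vec.span_image_scale[of "{x}" "\<lambda>_. c"] assms by simp

lemma span_singleton_eqD:
  assumes "vec.span {x} = vec.span {y :: 'k::field ^ 'n}"
  obtains c where "x = c *s y"
proof -
  have "x \<in> vec.span {y}" using vec.span_base[of x "{x}"] assms by simp
  then show ?thesis using that by (auto simp: vec.span_singleton)
qed

lemma scale_in_span_singleton: "c *s x \<in> vec.span {x :: 'k::field ^ 'n}"
  by (simp add: vec.span_base vec.span_scale)

lemma scale_vector_2: "c *s vector [x, y] = (vector [c * x, c * y] :: 'k::field ^ 2)"
  by (simp add: vec_eq_iff forall_2)

lemma vector_2_eq_iff: "vector [x, y] = (vector [x', y'] :: 'k::field ^ 2) \<longleftrightarrow> x = x' \<and> y = y'"
  by (auto simp: vec_eq_iff forall_2)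

lemma vector_2_eq_0_iff: "vector [x, y] = (0 :: 'k::field ^ 2) \<longleftrightarrow> x = 0 \<and> y = 0"
  by (auto simp: vec_eq_iff forall_2)

section \<open>The normal rational curve above a conjugate subline\<close>

context finite_field_extension
begin

text \<open>The factor between the two vectors is fixed by \<open>frob q s\<close>, hence lies in
  the ground field. This is the scatteredness of the linear set.\<close>

lemma span_frob_pair_eqD:
  assumes "coprime s t" "x \<noteq> 0" "y \<noteq> 0"
    and "vec.span {vector [x, frob q s x]} = vec.span {vector [y, frob q s y] :: 'k ^ 2}"
  obtains c where "c \<noteq> 0" "x = emb c * y"
proof -
  obtain k where "vector [x, frob q s x] = k *s (vector [y, frob q s y] :: 'k ^ 2)"
    using span_singleton_eqD[OF assms(4)] .
  then have k: "x = k * y" "frob q s x = k * frob q s y"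
    by (auto simp: scale_vector_2 vector_2_eq_iff)
  then have "frob q s k = k" using assms(3) by (auto simp: frob_mult)
  then obtain c where "k = emb c" using frob_fixed_coprime[OF assms(1) _ frob_t] by blast
  moreover from this have "c \<noteq> 0" using k assms(2) by auto
  ultimately show ?thesis using that k by blast
qed

text \<open>Here the exponent is already adapted to \<open>frob q s\<close>: \<open>conj\<close>
  uses its \<open>n\<close>-th power, and \<open>moved\<close> says that its powers 1 to
  \<open>n\<close> move \<open>a / b\<close>, which gives the independence of the
  \<open>n + 1\<close> coefficients.\<close>

lemma nrc_of_conjugate_subline:
  fixes w :: "'k \<Rightarrow> 'k ^ 'n" and \<psi> :: "'k ^ 2 \<Rightarrow> 'k ^ 'n"
  assumes cop: "coprime s t"
    and w_add: "\<And>x y. w (x + y) = w x + w y"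
    and w_scale: "\<And>c x. w (emb c * x) = emb c *s w x"
    and w_inj: "inj w" and W: "range w = W"
    and "inj \<psi>"
    and proj: "\<And>x. x \<noteq> 0 \<Longrightarrow> proj_from G M (vec.span {w x}) = \<psi> ` vec.span {vector [x, frob q s x]}"
    and disj: "kpoints W \<inter> kpoints G = {}"
    and r: "r = (`) \<psi> ` {vec.span {vector [emb i * b + emb j * a, emb i * d + emb j * c]} | i j. (i, j) \<noteq> (0, 0)}"
    and nz: "b \<noteq> 0" "d \<noteq> 0" and norm: "norm_q q t b = norm_q q t d"
    and conj: "c / d = frob q (s * n) (a / b)"
    and "n \<ge> 1" and moved: "\<And>j. 1 \<le> j \<Longrightarrow> j \<le> n \<Longrightarrow> frob q (s * j) (a / b) \<noteq> a / b"
  shows "nrc_in_subgeometry emb W n (kpoints W \<inter> proj_preimage G M r)"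
proof -
  interpret fs: vector_space "fscale emb :: 'f \<Rightarrow> 'k ^ 'n \<Rightarrow> 'k ^ 'n"
    by (rule vector_space_fscale[OF emb])
  define \<alpha> where "\<alpha> = a / b"
  have a: "a = \<alpha> * b" using nz by (simp add: \<alpha>_def)
  have \<alpha>: "\<alpha> \<notin> range emb" using moved[of 1] \<open>n \<ge> 1\<close> by (auto simp: \<alpha>_def)
  have w_0: "w 0 = 0" using w_add[of 0 0] by simp
  have w_zero: "x = 0" if "w x = 0" for x
    using injD[OF w_inj, of x 0] that w_0 by simp
  have w_sum: "w (sum f I) = (\<Sum>i\<in>I. w (f i))" for f :: "nat \<Rightarrow> 'k" and I
    by (induction I rule: infinite_finite_induct) (simp_all add: w_add w_0)
  \<comment> \<open>By \<open>conj\<close> the same \<open>k\<close> serves for both basis vectors;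
    it has norm 1, as Hilbert 90 requires.\<close>
  define k where "k = d / frob q (s * n) b"
  have "norm_q q t k = 1" using nz norm by (simp add: k_def norm_q_divide)
  then have "k \<in> (\<lambda>x. frob q s x / x) ` (- {0})"
    unfolding frob_ratio_norm_one[OF cop] by simp
  then obtain \<kappa> where \<kappa>: "\<kappa> \<noteq> 0" "frob q s \<kappa> / \<kappa> = k"
    by blast
  have d: "d = k * frob q (s * n) b" and c: "c = k * frob q (s * n) a"
    using nz conj by (auto simp: k_def frob_divide field_simps)
  \<comment> \<open>A telescoping product: passing to \<open>frob q s (Z z)\<close> exchanges the
    factor \<open>z\<close> for \<open>frob q (s * n) z\<close>.\<close>
  define Z where "Z z = (\<Prod>j<n. frob q (s * j) z)" for z :: 'k
  have Z_nz: "Z z \<noteq> 0" if "z \<noteq> 0" for z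
    using that by (simp add: Z_def)
  have Z_frob: "frob q s (Z z) * z = Z z * frob q (s * n) z" for z
  proof -
    have "frob q s (Z z) * z = (\<Prod>j<Suc n. frob q (s * j) z)"
      unfolding prod.lessThan_Suc_shift by (simp add: Z_def frob_prod frob_frob mult.commute)
    then show ?thesis by (simp add: Z_def)
  qed
  have Z_scale: "Z (emb i * z) = emb (i ^ n) * Z z" for i z
    by (simp add: Z_def frob_mult prod.distrib emb_power)
  define z where "z i j = emb i * b + emb j * a" for i j
  have z_nz: "z i j \<noteq> 0" if "(i, j) \<noteq> (0, 0)" for i j
  proof
    assume "z i j = 0"
    then have 0: "emb i + emb j * \<alpha> = 0" using nz by (auto simp: z_def a simp flip: distrib_right mult.assoc)
    show False
    proof (cases "j = 0")
      case True
      then show False using 0 that by simp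
    next
      case False
      then have "\<alpha> = emb (- i / j)" using 0 by (simp add: emb_divide emb_minus field_simps eq_neg_iff_add_eq_0)
      then show False using \<alpha> by blast
    qed
  qed
  \<comment> \<open>Scaling by \<open>\<kappa> * Z (z i j) / z i j\<close> brings both coordinates
    into the required form, by the telescoping and the choice of \<open>\<kappa>\<close>.\<close>
  have pt: "vec.span {vector [emb i * b + emb j * a, emb i * d + emb j * c]} =
      vec.span {vector [\<kappa> * Z (z i j), frob q s (\<kappa> * Z (z i j))] :: 'k ^ 2}"
    if "(i, j) \<noteq> (0, 0)" for i j
  proof -
    have "emb i * d + emb j * c = k * frob q (s * n) (z i j)"
      by (simp add: c d z_def frob_add frob_mult algebra_simps)
    moreover have "\<kappa> * Z (z i j) / z i j \<noteq> 0" using \<kappa> z_nz[OF that] Z_nz by simp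
    moreover have "\<kappa> * Z (z i j) / z i j * (k * frob q (s * n) (z i j)) = frob q s (\<kappa> * Z (z i j))"
    proof -
      have "\<kappa> * Z (z i j) / z i j * (k * frob q (s * n) (z i j)) =
          \<kappa> * k * (Z (z i j) * frob q (s * n) (z i j)) / z i j"
        by simp
      also have "\<dots> = \<kappa> * k * (frob q s (Z (z i j)) * z i j) / z i j"
        by (simp only: Z_frob)
      also have "\<dots> = frob q s \<kappa> * frob q s (Z (z i j))"
        using z_nz[OF that] \<kappa> by auto
      finally show ?thesis by (simp add: frob_mult)
    qed
    moreover have "\<kappa> * Z (z i j) / z i j * z i j = \<kappa> * Z (z i j)"
      using z_nz[OF that] by simp
    ultimately show ?thesis
      using span_singleton_scale[of "\<kappa> * Z (z i j) / z i j" "vector [z i j, k * frob q (s * n) (z i j)] :: 'k ^ 2"]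
      by (simp add: scale_vector_2 z_def)
  qed
  have r': "r = (`) \<psi> ` {vec.span {vector [\<kappa> * Z (z i j), frob q s (\<kappa> * Z (z i j))]} | i j. (i, j) \<noteq> (0, 0)}"
    unfolding r using pt by (intro arg_cong[of _ _ "image ((`) \<psi>)"]) blast
  \<comment> \<open>By scatteredness \<open>w (\<kappa> * Z (z i j))\<close> spans the only point of
    the subgeometry above the given point of \<open>r\<close>.\<close>
  have points: "kpoints W \<inter> proj_preimage G M r = {vec.span {w (\<kappa> * Z (z i j))} | i j. (i, j) \<noteq> (0, 0)}"
  proof (intro equalityI subsetI)
    fix P assume P: "P \<in> kpoints W \<inter> proj_preimage G M r"
    then obtain x where "w x \<noteq> 0" "P = vec.span {w x}"
      using W by (auto simp: kpoints_def)
    then have x: "x \<noteq> 0" "P = vec.span {w x}" using w_0 by auto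
    with P proj have "\<psi> ` vec.span {vector [x, frob q s x]} \<in> r"
      by (auto simp: proj_preimage_def)
    then obtain i j where ij: "(i, j) \<noteq> (0, 0)"
      and "\<psi> ` vec.span {vector [x, frob q s x]} = \<psi> ` vec.span {vector [\<kappa> * Z (z i j), frob q s (\<kappa> * Z (z i j))]}"
      unfolding r' by blast
    then have "vec.span {vector [x, frob q s x]} =
        vec.span {vector [\<kappa> * Z (z i j), frob q s (\<kappa> * Z (z i j))] :: 'k ^ 2}"
      using \<open>inj \<psi>\<close> by (simp add: inj_image_eq_iff)
    moreover have "\<kappa> * Z (z i j) \<noteq> 0" using \<kappa> Z_nz z_nz[OF ij] by simp
    ultimately obtain e where "e \<noteq> 0" "x = emb e * (\<kappa> * Z (z i j))"
      using span_frob_pair_eqD[OF cop x(1)] by blast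
    then have "P = vec.span {w (\<kappa> * Z (z i j))}"
      unfolding x(2) by (simp add: w_scale span_singleton_scale)
    then show "P \<in> {vec.span {w (\<kappa> * Z (z i j))} | i j. (i, j) \<noteq> (0, 0)}" using ij by blast
  next
    fix P assume "P \<in> {vec.span {w (\<kappa> * Z (z i j))} | i j. (i, j) \<noteq> (0, 0)}"
    then obtain i j where ij: "(i, j) \<noteq> (0, 0)" and P: "P = vec.span {w (\<kappa> * Z (z i j))}" by blast
    have nz: "\<kappa> * Z (z i j) \<noteq> 0" using \<kappa> Z_nz z_nz[OF ij] by simp
    then have "w (\<kappa> * Z (z i j)) \<noteq> 0" using w_zero by blast
    then have kp: "P \<in> kpoints W" unfolding kpoints_def P using W by blast
    have "proj_from G M P \<in> r" unfolding P proj[OF nz] r' using ij by blast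
    moreover have "P \<in> kpoints UNIV" "P \<notin> kpoints G" using kp disj by (auto simp: kpoints_def)
    ultimately show "P \<in> kpoints W \<inter> proj_preimage G M r"
      using kp by (simp add: proj_preimage_def)
  qed
  \<comment> \<open>For \<open>z = b * (\<alpha> + emb l)\<close> the product \<open>Z z\<close> is
    \<open>Z b\<close> times the value of \<open>C\<close> at \<open>emb l\<close>, so the
    coefficients of \<open>C\<close> yield the basis \<open>v\<close>.\<close>
  define C where "C = (\<Prod>j<n. [:frob q (s * j) \<alpha>, 1:])"
  have deg: "degree C = n"
    by (simp add: C_def degree_prod_eq_sum_degree)
  have monic: "poly.coeff C n = 1"
    using lead_coeff_prod[of "\<lambda>j. [:frob q (s * j) \<alpha>, 1:]" "{..<n}"] deg by (simp add: C_def)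
  define v where "v i = w (\<kappa> * Z b * poly.coeff C i)" for i
  have comb: "(\<Sum>i\<le>n. fscale emb (g i) (v i)) = w (\<kappa> * Z b * (\<Sum>i\<le>n. emb (g i) * poly.coeff C i))" for g
    by (simp add: fscale_def v_def w_sum sum_distrib_left mult.left_commute flip: w_scale)
  have curve_l: "(\<Sum>i\<le>n. fscale emb (l ^ i) (v i)) = w (\<kappa> * Z (z l 1))" for l
  proof -
    have "z l 1 = b * (\<alpha> + emb l)" by (simp add: z_def a algebra_simps)
    then have "Z (z l 1) = Z b * poly C (emb l)"
      by (simp add: Z_def C_def poly_prod frob_mult frob_add prod.distrib)
    also have "poly C (emb l) = (\<Sum>i\<le>n. emb (l ^ i) * poly.coeff C i)"
      by (simp add: poly_altdef deg emb_power mult.commute)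
    finally show ?thesis by (simp add: comb mult.assoc)
  qed
  \<comment> \<open>The point at infinity: \<open>C\<close> is monic, so the last basis vector is
    \<open>w (\<kappa> * Z b)\<close>, and \<open>b = z 1 0\<close>.\<close>
  have curve_inf: "(\<Sum>i\<le>n. fscale emb (if i = n then 1 else 0) (v i)) = w (\<kappa> * Z (z 1 0))"
  proof -
    have "(\<Sum>i\<le>n. emb (if i = n then 1 else 0) * poly.coeff C i) = (\<Sum>i\<le>n. if i = n then poly.coeff C i else 0)"
      by (rule sum.cong) auto
    also have "\<dots> = 1" by (simp add: monic)
    finally show ?thesis by (simp add: comb z_def)
  qed
  have zero: "g i = 0" if "(\<Sum>i\<le>n. fscale emb (g i) (v i)) = 0" "i \<in> {..n}" for g i
  proof -
    have "(\<Sum>i\<le>n. emb (g i) * poly.coeff C i) = 0"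
      using that(1) w_zero \<kappa> Z_nz[OF nz(1)] unfolding comb by fastforce
    then show ?thesis
      using coeffs_conjugate_prod_independent[of n s \<alpha> g i] moved that(2) by (simp add: C_def \<alpha>_def)
  qed
  have indep: "inj_on v {..n}" "fs.independent (v ` {..n})"
    using fs.independent_family[of "{..n}" v] zero by blast+
  have W_sub: "fs.subspace W"
    unfolding fs.subspace_def
  proof (intro conjI ballI allI)
    show "0 \<in> W" using W w_0 by (metis rangeI)
    show "x + y \<in> W" if "x \<in> W" "y \<in> W" for x y
      using that w_add by (auto simp: W[symmetric] simp flip: w_add)
    show "fscale emb e x \<in> W" if "x \<in> W" for e x
      using that by (auto simp: W[symmetric] fscale_def simp flip: w_scale)
  qed
  have "fs.span (v ` {..n}) \<subseteq> W"
    by (rule fs.span_minimal[OF _ W_sub]) (use W in \<open>auto simp: v_def\<close>)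
  moreover have "fs.dim (fs.span (v ` {..n})) = n + 1"
    using fs.dim_span_eq_card_independent[OF indep(2)] card_image[OF indep(1)] by simp
  moreover have "normal_rational_curve emb n (fs.span (v ` {..n})) (kpoints W \<inter> proj_preimage G M r)"
    unfolding normal_rational_curve_def
  proof (intro exI[of _ v] conjI)
    have "{vec.span {\<Sum>i\<le>n. fscale emb (c i) (v i)} | c. c \<in> standard_nrc n} =
        {vec.span {w (\<kappa> * Z (z l 1))} | l. True} \<union> {vec.span {w (\<kappa> * Z (z 1 0))}}"
    proof -
      have "{f c | c. c \<in> {g l | l. True} \<union> {g'}} = {f (g l) | l. True} \<union> {f g'}"
        for f :: "(nat \<Rightarrow> 'f) \<Rightarrow> ('k ^ 'n) set" and g :: "'f \<Rightarrow> nat \<Rightarrow> 'f" and g'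
        by blast
      from this[of "\<lambda>c. vec.span {\<Sum>i\<le>n. fscale emb (c i) (v i)}" "\<lambda>l i. l ^ i"]
      show ?thesis
        unfolding standard_nrc_def curve_inf[symmetric] curve_l[symmetric] by simp
    qed
    also have "\<dots> = {vec.span {w (\<kappa> * Z (z i j))} | i j. (i, j) \<noteq> (0, 0)}"
    proof (intro equalityI subsetI)
      fix P assume "P \<in> {vec.span {w (\<kappa> * Z (z i j))} | i j. (i, j) \<noteq> (0, 0)}"
      then obtain i j where ij: "(i, j) \<noteq> (0, 0)" and P: "P = vec.span {w (\<kappa> * Z (z i j))}" by blast
      \<comment> \<open>By homogeneity of \<open>Z\<close> over the ground field, every pair
        \<open>(i, j)\<close> reduces to \<open>(l, 1)\<close> or \<open>(1, 0)\<close>.\<close>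
      have scaled: "P = vec.span {w (\<kappa> * Z y)}" if "e \<noteq> 0" "z i j = emb e * y" for e y
      proof -
        have "w (\<kappa> * Z (z i j)) = emb (e ^ n) *s w (\<kappa> * Z y)"
          using w_scale[of "e ^ n" "\<kappa> * Z y"] by (simp add: that(2) Z_scale mult.left_commute)
        then show ?thesis using that(1) unfolding P by (simp add: span_singleton_scale)
      qed
      show "P \<in> {vec.span {w (\<kappa> * Z (z l 1))} | l. True} \<union> {vec.span {w (\<kappa> * Z (z 1 0))}}"
      proof (cases "j = 0")
        case True
        then have "P = vec.span {w (\<kappa> * Z (z 1 0))}"
          using ij by (intro scaled[of i]) (auto simp: z_def)
        then show ?thesis by blast
      next
        case False
        then have "P = vec.span {w (\<kappa> * Z (z (i / j) 1))}"
          by (intro scaled[of j]) (auto simp: z_def emb_divide field_simps)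
        then show ?thesis by blast
      qed
    next
      fix P assume "P \<in> {vec.span {w (\<kappa> * Z (z l 1))} | l. True} \<union> {vec.span {w (\<kappa> * Z (z 1 0))}}"
      then show "P \<in> {vec.span {w (\<kappa> * Z (z i j))} | i j. (i, j) \<noteq> (0, 0)}"
        by auto (metis zero_neq_one)+
    qed
    finally show "kpoints W \<inter> proj_preimage G M r =
        {vec.span {\<Sum>i\<le>n. fscale emb (c i) (v i)} | c. c \<in> standard_nrc n}"
      unfolding points by simp
  qed (use indep in auto)
  ultimately show ?thesis
    unfolding nrc_in_subgeometry_def by (intro exI[of _ "fs.span (v ` {..n})"]) simp
qed

text \<open>The least period \<open>m\<close> of \<open>a / b\<close> under the Frobenius map is its
  degree over the ground field. As \<open>s\<close> is invertible modulo \<open>m\<close>,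
  \<open>frob q h\<close> acts on \<open>a / b\<close> as the \<open>n\<close>-th power of
  \<open>frob q s\<close> for some \<open>n < m\<close>; \<open>neq\<close> excludes
  \<open>n = 0\<close>.\<close>

lemma nrc_of_subline:
  fixes w :: "'k \<Rightarrow> 'k ^ 'n" and \<psi> :: "'k ^ 2 \<Rightarrow> 'k ^ 'n"
  assumes cop: "coprime s t"
    and w_add: "\<And>x y. w (x + y) = w x + w y"
    and w_scale: "\<And>c x. w (emb c * x) = emb c *s w x"
    and w_inj: "inj w" and W: "range w = W"
    and "inj \<psi>"
    and proj: "\<And>x. x \<noteq> 0 \<Longrightarrow> proj_from G M (vec.span {w x}) = \<psi> ` vec.span {vector [x, frob q s x]}"
    and disj: "kpoints W \<inter> kpoints G = {}"
    and r: "r = (`) \<psi> ` {vec.span {vector [emb i * b + emb j * a, emb i * d + emb j * c]} | i j. (i, j) \<noteq> (0, 0)}"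
    and nz: "b \<noteq> 0" "d \<noteq> 0" and norm: "norm_q q t b = norm_q q t d"
    and conj: "c / d = frob q h (a / b)" and neq: "c / d \<noteq> a / b"
  shows "\<exists>m n. m > 1 \<and> m dvd t \<and> 1 \<le> n \<and> n \<le> m - 1 \<and>
    [int n = int h * modular_inverse (int m) (int s)] (mod int m) \<and>
    nrc_in_subgeometry emb W n (kpoints W \<inter> proj_preimage G M r)"
proof -
  define \<alpha> where "\<alpha> = a / b"
  define m where "m = (LEAST m. m > 0 \<and> frob q m \<alpha> = \<alpha>)"
  have m: "m > 0" "frob q m \<alpha> = \<alpha>"
    using LeastI[of "\<lambda>m. m > 0 \<and> frob q m \<alpha> = \<alpha>" t] t_pos by (auto simp: m_def)
  have least: "frob q j \<alpha> \<noteq> \<alpha>" if "0 < j" "j < m" for j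
    using not_less_Least[of j "\<lambda>m. m > 0 \<and> frob q m \<alpha> = \<alpha>"] that by (auto simp: m_def)
  have red: "frob q i \<alpha> = frob q (i mod m) \<alpha>" for i
  proof -
    have "frob q i \<alpha> = frob q (i mod m) (frob q (m * (i div m)) \<alpha>)"
      by (simp add: frob_frob)
    then show ?thesis by (simp add: frob_fixed_multiple[OF m(2)])
  qed
  have fixed_iff: "frob q i \<alpha> = \<alpha> \<longleftrightarrow> m dvd i" for i
  proof
    assume "frob q i \<alpha> = \<alpha>"
    then have "i mod m = 0" using red[of i] least[of "i mod m"] m(1) by force
    then show "m dvd i" by auto
  next
    assume "m dvd i"
    then show "frob q i \<alpha> = \<alpha>" using red[of i] by simp
  qed
  have mt: "m dvd t" using fixed_iff[of t] by simp
  have nh: "\<not> m dvd h" using conj neq fixed_iff[of h] by (simp add: \<alpha>_def)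
  then have "m > 1" using m(1) by (cases "m = 1") auto
  have "coprime s m" using cop mt coprime_divisors[of s s m t] by simp
  then have cop_m: "coprime (int s) (int m)" by simp
  define N where "N = (int h * modular_inverse (int m) (int s)) mod int m"
  define n where "n = nat N"
  have n: "int n = N" using \<open>m > 1\<close> by (simp add: n_def N_def)
  have cong_n: "[int n = int h * modular_inverse (int m) (int s)] (mod int m)"
    by (simp add: n N_def cong_def)
  have "[int s * int n = int s * (int h * modular_inverse (int m) (int s))] (mod int m)"
    using cong_n by (rule cong_scalar_left)
  also have "int s * (int h * modular_inverse (int m) (int s)) = int h * (int s * modular_inverse (int m) (int s))"
    by simp
  also have "[\<dots> = int h * 1] (mod int m)"
    using cong_modular_inverse1[OF cop_m] by (rule cong_scalar_left)
  finally have "[s * n = h] (mod m)"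
    by (simp flip: cong_int_iff)
  then have sn: "frob q (s * n) \<alpha> = frob q h \<alpha>"
    using red[of "s * n"] red[of h] by (simp add: cong_def)
  have "n \<ge> 1"
  proof (rule ccontr)
    assume "\<not> n \<ge> 1"
    then have "n = 0" by simp
    then show False using sn nh fixed_iff[of h] by simp
  qed
  have "n < m" using \<open>m > 1\<close> n by (simp add: N_def n_def nat_less_iff)
  have "nrc_in_subgeometry emb W n (kpoints W \<inter> proj_preimage G M r)"
  proof (rule nrc_of_conjugate_subline[OF cop w_add w_scale w_inj W \<open>inj \<psi>\<close> proj disj r nz norm _ \<open>n \<ge> 1\<close>])
    show "c / d = frob q (s * n) (a / b)" using conj sn by (simp add: \<alpha>_def)
    \<comment> \<open>As \<open>s\<close> is prime to \<open>m\<close>, \<open>s * j\<close> is no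
      multiple of \<open>m\<close> for \<open>0 < j < m\<close>.\<close>
    fix j assume "1 \<le> j" "j \<le> n"
    then have "\<not> m dvd j" using \<open>n < m\<close> by (auto dest: dvd_imp_le)
    then have "\<not> m dvd s * j" using \<open>coprime s m\<close> by (simp add: coprime_dvd_mult_right_iff coprime_commute)
    then show "frob q (s * j) (a / b) \<noteq> a / b" using fixed_iff[of "s * j"] by (simp add: \<alpha>_def)
  qed
  then show ?thesis
    using \<open>m > 1\<close> mt \<open>n \<ge> 1\<close> \<open>n < m\<close> cong_n by (intro exI[of _ m] exI[of _ n]) auto
qed

end

section \<open>Projections and sublines\<close>

lemma line_isoD:
  assumes "line_iso \<phi> M"
  shows "\<phi> (x + y) = \<phi> x + \<phi> y" and "\<phi> (c *s x) = c *s \<phi> x" and "inj \<phi>" and "range \<phi> = M"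
  using assms by (auto simp: line_iso_def Vector_Spaces.linear_iff bij_betw_def)

lemma image_span_singleton:
  assumes "\<And>c x. \<psi> (c *s x) = c *s \<psi> x"
  shows "\<psi> ` vec.span {x :: 'k::field ^ 'm} = vec.span {\<psi> x :: 'k ^ 'n}"
  by (simp add: vec.span_singleton image_image assms)

text \<open>Disjointness and the dimensions make \<open>G\<close> and \<open>M\<close>
  complementary; linearity of \<open>p\<close> follows from the uniqueness of the component in
  \<open>M\<close>.\<close>

lemma projection_along:
  fixes G M :: "('k::field ^ 'n) set"
  assumes G: "vec.subspace G" and M: "vec.subspace M" and dim: "vec.dim G + vec.dim M = CARD('n)"
    and disj: "kpoints M \<inter> kpoints G = {}"
  obtains p where "\<forall>x y. p (x + y) = p x + p y" and "\<forall>c x. p (c *s x) = c *s p x"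
    and "\<forall>x. p x \<in> M" and "\<forall>x. x - p x \<in> G"
    and "\<forall>x\<in>G. \<forall>y\<in>M. p (x + y) = y"
proof -
  have inter: "G \<inter> M = {0}"
  proof -
    have "x = 0" if "x \<in> G" "x \<in> M" for x
    proof (rule ccontr)
      assume "x \<noteq> 0"
      then have "vec.span {x} \<in> kpoints M \<inter> kpoints G" using that by (auto simp: kpoints_def)
      then show False using disj by simp
    qed
    then show ?thesis using G M vec.subspace_0 by blast
  qed
  have sum_eq: "{x + y | x y. x \<in> G \<and> y \<in> M} = UNIV"
  proof (rule vec.subspace_dim_equal)
    show "vec.subspace {x + y | x y. x \<in> G \<and> y \<in> M}" using G M by (rule vec.subspace_sums)
    show "vec.dim (UNIV :: ('k ^ 'n) set) \<le> vec.dim {x + y | x y. x \<in> G \<and> y \<in> M}"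
      using vec.dim_sums_Int[OF G M] dim inter by (simp add: card_cart_basis)
  qed auto
  have ex: "\<exists>y\<in>M. x - y \<in> G" for x
  proof -
    have "x \<in> {x + y | x y. x \<in> G \<and> y \<in> M}" unfolding sum_eq by simp
    then obtain g y where "x = g + y" "g \<in> G" "y \<in> M" by blast
    then show ?thesis by (intro bexI[of _ y]) simp_all
  qed
  have unique: "y = y'" if "y \<in> M" "y' \<in> M" "x - y \<in> G" "x - y' \<in> G" for x y y'
  proof -
    have "(x - y') - (x - y) \<in> G" using vec.subspace_diff[OF G that(4,3)] .
    moreover have "y - y' \<in> M" using vec.subspace_diff[OF M that(1,2)] .
    ultimately have "y - y' \<in> G \<inter> M" by simp
    then show ?thesis unfolding inter by simp
  qed
  from ex obtain p where p: "\<And>x. p x \<in> M" "\<And>x. x - p x \<in> G" by metis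
  have "p (x + y) = p x + p y" for x y
    using vec.subspace_add[OF M p(1)[of x] p(1)[of y]] vec.subspace_add[OF G p(2)[of x] p(2)[of y]]
    by (intro unique[of _ _ "x + y"] p) (simp_all add: algebra_simps)
  moreover have "p (c *s x) = c *s p x" for c x
    using vec.subspace_scale[OF M p(1)[of x], of c] vec.subspace_scale[OF G p(2)[of x], of c]
    by (intro unique[of _ _ "c *s x"] p) (simp_all add: vec.scale_right_diff_distrib)
  moreover have "p (x + y) = y" if "x \<in> G" "y \<in> M" for x y
    using that by (intro unique[of _ _ "x + y"] p) simp_all
  ultimately show thesis using p by (intro that[of p]) simp_all
qed

text \<open>A vector \<open>g + k *s x\<close> of \<open>M\<close> is fixed by \<open>p\<close>,
  which kills \<open>g\<close>, so it equals \<open>k *s p x\<close>. Thus the projection of points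
  becomes the linear map \<open>p\<close> on vectors.\<close>

lemma proj_from_span_singleton:
  fixes G M :: "('k::field ^ 'n) set"
  assumes G: "vec.subspace G" and M: "vec.subspace M"
    and p: "\<And>x y. p (x + y) = p x + p y" "\<And>c x. p (c *s x) = c *s p x"
      "\<And>x. p x \<in> M" "\<And>x. x - p x \<in> G" "\<And>x y. x \<in> G \<Longrightarrow> y \<in> M \<Longrightarrow> p (x + y) = y"
  shows "proj_from G M (vec.span {x}) = vec.span {p x}"
proof -
  have span: "vec.span (G \<union> vec.span {x}) = {g + y | g y. g \<in> G \<and> y \<in> vec.span {x}}"
    unfolding vec.span_Un using G by (simp add: vec.span_eq_iff[THEN iffD2] vec.span_span)
  show ?thesis
    unfolding proj_from_def span
  proof (intro equalityI subsetI)
    fix u assume "u \<in> {g + y | g y. g \<in> G \<and> y \<in> vec.span {x}} \<inter> M"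
    then obtain g k where u: "u = g + k *s x" "g \<in> G" "u \<in> M"
      by (auto simp: vec.span_singleton)
    have "p g = 0" using p(5)[OF u(2) vec.subspace_0[OF M]] by simp
    moreover have "p u = u" using p(5)[OF vec.subspace_0[OF G] u(3)] by simp
    ultimately have "u = k *s p x" using p(1)[of g "k *s x"] p(2) u(1) by simp
    then show "u \<in> vec.span {p x}" unfolding vec.span_singleton by (rule range_eqI)
  next
    fix u assume "u \<in> vec.span {p x}"
    then obtain k where u: "u = k *s p x" by (auto simp: vec.span_singleton)
    have "- (k *s (x - p x)) \<in> G"
      using vec.subspace_neg[OF G vec.subspace_scale[OF G p(4)]] .
    moreover have "u = - (k *s (x - p x)) + k *s x"
      by (simp add: u vec.scale_right_diff_distrib)
    moreover have "u \<in> M" unfolding u by (rule vec.subspace_scale[OF M p(3)])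
    moreover have "k *s x \<in> vec.span {x}" by (rule scale_in_span_singleton)
    ultimately show "u \<in> {g + y | g y. g \<in> G \<and> y \<in> vec.span {x}} \<inter> M" by blast
  qed
qed

section \<open>Points of sublines and of transversals, by counting\<close>

context finite_field_extension
begin

lemma fdim_subspace_basis:
  assumes "fsubspace emb U" "fdim emb U = d" "d > 0"
  obtains B :: "('k ^ 'n) set" where "B \<subseteq> U" "findependent emb B" "fspan emb B = U" "finite B" "card B = d"
    "card U = q ^ d"
proof -
  interpret fs: vector_space "fscale emb :: 'f \<Rightarrow> 'k ^ 'n \<Rightarrow> 'k ^ 'n"
    by (rule vector_space_fscale[OF emb])
  obtain B where B: "B \<subseteq> U" "fs.independent B" "U \<subseteq> fs.span B" "card B = fs.dim U"
    by (rule fs.basis_exists)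
  then have "card B = d" using assms(2) by simp
  moreover from this have "finite B" using assms(3) card_ge_0_finite by auto
  moreover have "fs.span B = U" using B fs.span_minimal[OF B(1) assms(1)] by blast
  moreover have "card U = q ^ d"
    using fs.card_span_independent[OF \<open>finite B\<close> B(2)] card_f \<open>card B = d\<close> \<open>fs.span B = U\<close> by simp
  ultimately show thesis using that B by blast
qed

lemma finite_kvec [simp]: "finite (S :: ('k ^ 'm) set)"
proof -
  have "finite ((\<lambda>f. \<chi> i. f i) ` (UNIV \<rightarrow>\<^sub>E (UNIV :: 'k set)) :: ('k ^ 'm) set)"
    by (intro finite_imageI finite_PiE) simp_all
  moreover have "UNIV = ((\<lambda>f. \<chi> i. f i) ` (UNIV \<rightarrow>\<^sub>E UNIV) :: ('k ^ 'm) set)"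
  proof -
    have "x \<in> (\<lambda>f. \<chi> i. f i) ` (UNIV \<rightarrow>\<^sub>E UNIV)" for x :: "'k ^ 'm"
      by (rule image_eqI[where x = "\<lambda>i. x $ i"]) auto
    then show ?thesis by auto
  qed
  ultimately have "finite (UNIV :: ('k ^ 'm) set)" by (simp only:)
  then show ?thesis by (rule finite_subset[OF subset_UNIV])
qed

text \<open>The lower bound suffices: against the at most \<open>q + 1\<close> points carried by a
  transversal it forces equality.\<close>

lemma card_subline_ge:
  fixes M :: "('k ^ 'n) set"
  assumes "subline emb M r"
  shows "card r \<ge> q + 1"
proof -
  obtain \<phi> where \<phi>: "line_iso \<phi> M"
    and r: "r = (`) \<phi> ` {vec.span {vector [emb a, emb b]} | a b. (a, b) \<noteq> (0, 0)}"
    using assms by (auto simp: subline_def)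
  define R where "R = {vec.span {vector [emb a, emb b] :: 'k ^ 2} | a b. (a, b) \<noteq> (0, 0)}"
  define pt where "pt l = vec.span {vector [emb l, 1] :: 'k ^ 2}" for l
  define pt0 where "pt0 = vec.span {vector [1, 0] :: 'k ^ 2}"
  have "inj pt"
  proof (rule injI)
    fix l l' assume "pt l = pt l'"
    then obtain c where "vector [emb l, 1] = c *s (vector [emb l', 1] :: 'k ^ 2)"
      unfolding pt_def by (rule span_singleton_eqD)
    then show "l = l'" by (auto simp: scale_vector_2 vector_2_eq_iff)
  qed
  moreover have "pt0 \<notin> range pt"
  proof
    assume "pt0 \<in> range pt"
    then obtain l where "pt l = pt0" by auto
    then obtain c where "vector [emb l, 1] = c *s (vector [1, 0] :: 'k ^ 2)"
      unfolding pt_def pt0_def by (rule span_singleton_eqD)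
    then show False by (simp add: scale_vector_2 vector_2_eq_iff)
  qed
  ultimately have "card (insert pt0 (range pt)) = q + 1"
    using card_f by (simp add: card_image)
  moreover have "insert pt0 (range pt) \<subseteq> R"
  proof -
    have "pt l \<in> R" for l unfolding R_def pt_def
      by (intro CollectI exI[of _ l] exI[of _ 1]) simp
    moreover have "pt0 \<in> R" unfolding R_def pt0_def
      by (intro CollectI exI[of _ 1] exI[of _ 0]) simp
    ultimately show ?thesis by auto
  qed
  moreover have "finite R"
    by (rule finite_subset[of _ "Pow (\<Union>R)"]) auto
  ultimately have "card R \<ge> q + 1" by (metis card_mono)
  moreover have "card r = card R"
    unfolding r R_def[symmetric]
    by (rule card_image) (use line_isoD(3)[OF \<phi>] in \<open>auto simp: inj_on_def inj_image_eq_iff\<close>)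
  ultimately show ?thesis by simp
qed

text \<open>A basis of \<open>T\<close> provides the vectors \<open>(b, d)\<close> and
  \<open>(a, c)\<close>. Over the large field \<open>T\<close> has at most \<open>q + 1\<close>
  points, so \<open>R\<close> consists of all of them.\<close>

lemma subline_of_transversal:
  fixes T :: "('k ^ 2) set"
  assumes T: "fsubspace emb T" "fdim emb T = 2"
    and sub: "R \<subseteq> kpoints T" and card: "card R \<ge> q + 1"
    and S: "\<And>\<tau>. \<tau> \<in> T \<Longrightarrow> \<tau> \<noteq> 0 \<Longrightarrow> \<exists>z. z \<noteq> 0 \<and> \<tau> = vector [z, k * frob q h z]"
    and norm: "norm_q q t k = 1"
  obtains a b c d where "b \<noteq> 0" "d \<noteq> 0" "norm_q q t b = norm_q q t d"
    "c / d = frob q h (a / b)" "c / d \<noteq> a / b"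
    "R = {vec.span {vector [emb i * b + emb j * a, emb i * d + emb j * c]} | i j. (i, j) \<noteq> (0, 0)}"
proof -
  interpret fs: vector_space "fscale emb :: 'f \<Rightarrow> 'k ^ 2 \<Rightarrow> 'k ^ 2"
    by (rule vector_space_fscale[OF emb])
  obtain B where B: "B \<subseteq> T" "fs.independent B" "fs.span B = T" "finite B" "card B = 2"
    by (rule fdim_subspace_basis[OF T]) simp_all
  then obtain \<tau>\<^sub>1 \<tau>\<^sub>2 where \<tau>: "B = {\<tau>\<^sub>1, \<tau>\<^sub>2}" "\<tau>\<^sub>1 \<noteq> \<tau>\<^sub>2" by (metis card_2_iff)
  have \<tau>_T: "\<tau>\<^sub>1 \<in> T" "\<tau>\<^sub>2 \<in> T" using B(1) \<tau>(1) by auto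
  have nz: "\<tau>\<^sub>1 \<noteq> 0" "\<tau>\<^sub>2 \<noteq> 0" using B(2) \<tau> fs.dependent_zero by auto
  obtain b where b: "b \<noteq> 0" "\<tau>\<^sub>1 = vector [b, k * frob q h b]"
    using S[OF \<tau>_T(1) nz(1)] by auto
  obtain a where a: "a \<noteq> 0" "\<tau>\<^sub>2 = vector [a, k * frob q h a]"
    using S[OF \<tau>_T(2) nz(2)] by auto
  define c where "c = k * frob q h a"
  define d where "d = k * frob q h b"
  have "k \<noteq> 0" using norm norm_q_eq_0[of k] by auto
  then have "d \<noteq> 0" using b by (simp add: d_def)
  have comb: "emb i *s \<tau>\<^sub>1 + emb j *s \<tau>\<^sub>2 = vector [emb i * b + emb j * a, emb i * d + emb j * c]" for i j
    by (simp add: a b c_def d_def vec_eq_iff forall_2)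
  have in_T: "emb i *s \<tau>\<^sub>1 + emb j *s \<tau>\<^sub>2 \<in> T" for i j
  proof -
    have "fscale emb i \<tau>\<^sub>1 + fscale emb j \<tau>\<^sub>2 \<in> T"
      by (intro fs.subspace_add fs.subspace_scale T(1) \<tau>_T)
    then show ?thesis by (simp add: fscale_def)
  qed
  have T_eq: "T = {emb i *s \<tau>\<^sub>1 + emb j *s \<tau>\<^sub>2 | i j. True}"
  proof (intro equalityI subsetI)
    fix x assume "x \<in> T"
    then obtain u where "x = (\<Sum>v\<in>B. fscale emb (u v) v)"
      unfolding B(3)[symmetric] fs.span_finite[OF B(4)] by blast
    then have "x = emb (u \<tau>\<^sub>1) *s \<tau>\<^sub>1 + emb (u \<tau>\<^sub>2) *s \<tau>\<^sub>2"
      using \<tau> by (simp add: fscale_def)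
    then show "x \<in> {emb i *s \<tau>\<^sub>1 + emb j *s \<tau>\<^sub>2 | i j. True}" by blast
  next
    fix x assume "x \<in> {emb i *s \<tau>\<^sub>1 + emb j *s \<tau>\<^sub>2 | i j. True}"
    then show "x \<in> T" using in_T by blast
  qed
  have comb_nz: "emb i *s \<tau>\<^sub>1 + emb j *s \<tau>\<^sub>2 \<noteq> 0" if "(i, j) \<noteq> (0, 0)" for i j
  proof
    assume 0: "emb i *s \<tau>\<^sub>1 + emb j *s \<tau>\<^sub>2 = 0"
    define u where "u x = (if x = \<tau>\<^sub>1 then i else j)" for x
    have "(\<Sum>v\<in>B. fscale emb (u v) v) = 0" using 0 \<tau> by (simp add: u_def fscale_def)
    then have "u \<tau>\<^sub>1 = 0 \<and> u \<tau>\<^sub>2 = 0"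
      using fs.independentD[OF B(2,4) subset_refl] \<tau> by auto
    then show False using that \<tau> by (auto simp: u_def)
  qed
  have pts: "kpoints T = {vec.span {emb i *s \<tau>\<^sub>1 + emb j *s \<tau>\<^sub>2} | i j. (i, j) \<noteq> (0, 0)}"
  proof (intro equalityI subsetI)
    fix P assume "P \<in> kpoints T"
    then obtain i j where P: "P = vec.span {emb i *s \<tau>\<^sub>1 + emb j *s \<tau>\<^sub>2}" "emb i *s \<tau>\<^sub>1 + emb j *s \<tau>\<^sub>2 \<noteq> 0"
      unfolding kpoints_def T_eq by blast
    then have "(i, j) \<noteq> (0, 0)" by auto
    then show "P \<in> {vec.span {emb i *s \<tau>\<^sub>1 + emb j *s \<tau>\<^sub>2} | i j. (i, j) \<noteq> (0, 0)}"
      using P by blast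
  next
    fix P assume "P \<in> {vec.span {emb i *s \<tau>\<^sub>1 + emb j *s \<tau>\<^sub>2} | i j. (i, j) \<noteq> (0, 0)}"
    then obtain i j where ij: "(i, j) \<noteq> (0, 0)" "P = vec.span {emb i *s \<tau>\<^sub>1 + emb j *s \<tau>\<^sub>2}"
      by blast
    then show "P \<in> kpoints T"
      unfolding kpoints_def using in_T comb_nz[OF ij(1)] by blast
  qed
  define pt where "pt l = vec.span {emb l *s \<tau>\<^sub>1 + \<tau>\<^sub>2}" for l
  have normal: "kpoints T \<subseteq> insert (vec.span {\<tau>\<^sub>1}) (range pt)"
  proof
    fix P assume "P \<in> kpoints T"
    then obtain i j where ij: "(i, j) \<noteq> (0, 0)" "P = vec.span {emb i *s \<tau>\<^sub>1 + emb j *s \<tau>\<^sub>2}"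
      unfolding pts by blast
    show "P \<in> insert (vec.span {\<tau>\<^sub>1}) (range pt)"
    proof (cases "j = 0")
      case True
      then show ?thesis using ij span_singleton_scale[of "emb i" \<tau>\<^sub>1] by simp
    next
      case False
      have "emb i *s \<tau>\<^sub>1 + emb j *s \<tau>\<^sub>2 = emb j *s (emb (i / j) *s \<tau>\<^sub>1 + \<tau>\<^sub>2)"
        using False by (simp add: vec.scale_right_distrib emb_divide)
      then have "P = pt (i / j)"
        using False unfolding ij(2) pt_def by (simp only: span_singleton_scale emb_eq_0 not_False_eq_True)
      then show ?thesis by blast
    qed
  qed
  have "card (kpoints T) \<le> card (insert (vec.span {\<tau>\<^sub>1}) (range pt))"
    by (rule card_mono[OF _ normal]) simp
  also have "\<dots> \<le> Suc (card (range pt))" by (rule card_insert_le_m1) simp_all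
  also have "\<dots> \<le> q + 1" using card_image_le[of UNIV pt] card_f by simp
  finally have card_T: "card (kpoints T) \<le> q + 1" .
  have fin: "finite (kpoints T)" using normal by (rule finite_subset) simp
  have R: "R = kpoints T"
    using card_seteq[OF fin sub] card card_T by simp
  have conj: "c / d = frob q h (a / b)" using \<open>k \<noteq> 0\<close> by (simp add: c_def d_def frob_divide)
  \<comment> \<open>Equality would collapse all vectors of \<open>T\<close> to a single point,
    contrary to the size of \<open>R\<close>.\<close>
  have neq: "c / d \<noteq> a / b"
  proof
    assume "c / d = a / b"
    then have "\<tau>\<^sub>2 = (a / b) *s \<tau>\<^sub>1"
      unfolding a(2) b(2) scale_vector_2 vector_2_eq_iff c_def[symmetric] d_def[symmetric]
      using b(1) \<open>d \<noteq> 0\<close> by (simp add: field_simps)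
    then have single: "emb i *s \<tau>\<^sub>1 + emb j *s \<tau>\<^sub>2 = (emb i + emb j * (a / b)) *s \<tau>\<^sub>1" for i j
      by (simp add: vec.scale_left_distrib)
    have "kpoints T \<subseteq> {vec.span {\<tau>\<^sub>1}}"
    proof
      fix P assume "P \<in> kpoints T"
      then obtain i j where ij: "(i, j) \<noteq> (0, 0)" "P = vec.span {emb i *s \<tau>\<^sub>1 + emb j *s \<tau>\<^sub>2}"
        unfolding pts by blast
      have "emb i + emb j * (a / b) \<noteq> 0" 
        using comb_nz[OF ij(1), unfolded single] by (metis vec.scale_zero_left)
      then have "P = vec.span {\<tau>\<^sub>1}" unfolding ij(2) single by (rule span_singleton_scale)
      then show "P \<in> {vec.span {\<tau>\<^sub>1}}" by simp
    qed
    then have "card (kpoints T) \<le> 1" using card_mono[of "{vec.span {\<tau>\<^sub>1}}"] by simp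
    then show False using card R q_pos by simp
  qed
  have norm_eq: "norm_q q t b = norm_q q t d" using norm by (simp add: d_def norm_q_mult)
  have "R = {vec.span {vector [emb i * b + emb j * a, emb i * d + emb j * c]} | i j. (i, j) \<noteq> (0, 0)}"
    unfolding R pts comb ..
  with b(1) \<open>d \<noteq> 0\<close> norm_eq conj neq show thesis by (rule that)
qed

text \<open>Up to a scalar, a canonical subgeometry determines the vector space defining it: the vectors
  of a basis of \<open>W\<close>, and their sum, are multiples of vectors \<open>w\<^sub>0 x\<close>, and the factors are compared
  by expanding the last of these vectors in terms of the others.\<close>

lemma canonical_subgeometry_space_unique:
  fixes w\<^sub>0 :: "'k \<Rightarrow> 'k ^ 'n"
  assumes W: "canonical_subgeometry_space emb W" and t: "CARD('n) = t"
    and add: "\<And>x y. w\<^sub>0 (x + y) = w\<^sub>0 x + w\<^sub>0 y" and scale: "\<And>c x. w\<^sub>0 (emb c * x) = emb c *s w\<^sub>0 x"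
    and zero: "\<And>x. w\<^sub>0 x = 0 \<Longrightarrow> x = 0"
    and pts: "kpoints W = {vec.span {w\<^sub>0 x} | x. x \<noteq> 0}"
  obtains c where "c \<noteq> 0" "W = range (\<lambda>x. c *s w\<^sub>0 x)"
proof -
  interpret fs: vector_space "fscale emb :: 'f \<Rightarrow> 'k ^ 'n \<Rightarrow> 'k ^ 'n"
    by (rule vector_space_fscale[OF emb])
  have "fsubspace emb W" "fdim emb W = t"
    using W t by (auto simp: canonical_subgeometry_space_def)
  then obtain B where B: "B \<subseteq> W" "fs.independent B" "fs.span B = W" "finite B" "card B = t"
    and card_W: "card W = q ^ t"
    using t_pos by (rule fdim_subspace_basis)
  \<comment> \<open>A ground field basis of \<open>W\<close> spans the whole space over the large
    field, and having \<open>t\<close> elements it is a basis there as well.\<close>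
  have "fs.span B \<subseteq> vec.span B"
  proof (rule fs.span_minimal[OF vec.span_superset])
    show "fs.subspace (vec.span B)"
      by (auto simp: fs.subspace_def fscale_def intro: vec.span_add vec.span_scale vec.span_zero)
  qed
  then have "vec.span W \<subseteq> vec.span B"
    using B(3) vec.span_minimal vec.subspace_span by metis
  then have "UNIV \<subseteq> vec.span B" using W by (simp add: canonical_subgeometry_space_def)
  then have vec_ind: "vec.independent B"
    using vec.card_eq_dim[of B UNIV] B t by (simp add: card_cart_basis)
  have nz: "b \<noteq> 0" if "b \<in> B" for b using that B(2) fs.dependent_zero by auto
  have mult: "\<exists>y k. k \<noteq> 0 \<and> w\<^sub>0 y = k *s x" if "x \<in> W" "x \<noteq> 0" for x
  proof -
    have "vec.span {x} \<in> kpoints W" using that by (auto simp: kpoints_def)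
    then obtain y where y: "y \<noteq> 0" "vec.span {w\<^sub>0 y} = vec.span {x}" unfolding pts by auto
    then obtain k where "w\<^sub>0 y = k *s x" by (blast elim: span_singleton_eqD)
    then show ?thesis using y zero by (intro exI[of _ y] exI[of _ k]) auto
  qed
  have "\<forall>b\<in>B. \<exists>y k. k \<noteq> 0 \<and> w\<^sub>0 y = k *s b"
    by (intro ballI mult nz) (use B(1) in auto)
  from bchoice[OF this] obtain y where "\<forall>b\<in>B. \<exists>k. k \<noteq> 0 \<and> w\<^sub>0 (y b) = k *s b" ..
  from bchoice[OF this] obtain k where "\<forall>b\<in>B. k b \<noteq> 0 \<and> w\<^sub>0 (y b) = k b *s b" ..
  then have yk: "k b \<noteq> 0 \<and> w\<^sub>0 (y b) = k b *s b" if "b \<in> B" for b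
    using that by blast
  have vec_zero: "g b = 0" if "(\<Sum>b\<in>B. g b *s b) = 0" "b \<in> B" for g b
    using vec.independentD[OF vec_ind B(4) subset_refl that] .
  have fam: "g b = 0" if "(\<Sum>b\<in>B. fscale emb (g b) (w\<^sub>0 (y b))) = 0" "b \<in> B" for g b
  proof -
    have "(\<Sum>b\<in>B. (emb (g b) * k b) *s b) = 0"
      using that(1) yk by (simp add: fscale_def cong: sum.cong)
    then have "emb (g b) * k b = 0" using that(2) by (rule vec_zero)
    then show ?thesis using yk[OF that(2)] by simp
  qed
  have ind: "inj_on (\<lambda>b. w\<^sub>0 (y b)) B" "fs.independent ((\<lambda>b. w\<^sub>0 (y b)) ` B)"
  proof -
    show "inj_on (\<lambda>b. w\<^sub>0 (y b)) B" "fs.independent ((\<lambda>b. w\<^sub>0 (y b)) ` B)"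
      using fs.independent_family[OF B(4), of "\<lambda>b. w\<^sub>0 (y b)"] fam by blast+
  qed
  have w\<^sub>0_0: "w\<^sub>0 0 = 0" using add[of 0 0] by simp
  have sub_w\<^sub>0: "fs.subspace (range w\<^sub>0)"
    unfolding fs.subspace_def
    by (auto simp: fscale_def simp flip: add scale intro: range_eqI[of _ _ 0] simp: w\<^sub>0_0)
  have card_w\<^sub>0: "card (range w\<^sub>0) \<le> q ^ t"
    using card_image_le[of UNIV w\<^sub>0] card_k by simp
  \<comment> \<open>The independent vectors \<open>w\<^sub>0 (y b)\<close> span \<open>q ^ t\<close>
    elements, and \<open>range w\<^sub>0\<close> has no more; hence they form a basis of it.\<close>
  have "fs.span ((\<lambda>b. w\<^sub>0 (y b)) ` B) = range w\<^sub>0"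
  proof (rule card_seteq)
    show "fs.span ((\<lambda>b. w\<^sub>0 (y b)) ` B) \<subseteq> range w\<^sub>0"
      by (rule fs.span_minimal[OF _ sub_w\<^sub>0]) auto
    have "card (fs.span ((\<lambda>b. w\<^sub>0 (y b)) ` B)) = q ^ t"
      using fs.card_span_independent[OF _ ind(2)] card_image[OF ind(1)] B card_f by simp
    then show "card (range w\<^sub>0) \<le> card (fs.span ((\<lambda>b. w\<^sub>0 (y b)) ` B))"
      using card_w\<^sub>0 by simp
  qed simp
  have expand: "\<exists>g. w\<^sub>0 x = (\<Sum>b\<in>B. (emb (g b) * k b) *s b)" for x
  proof -
    have "w\<^sub>0 x \<in> fs.span ((\<lambda>b. w\<^sub>0 (y b)) ` B)"
      unfolding \<open>fs.span ((\<lambda>b. w\<^sub>0 (y b)) ` B) = range w\<^sub>0\<close> by simp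
    then obtain u where "w\<^sub>0 x = (\<Sum>v\<in>(\<lambda>b. w\<^sub>0 (y b)) ` B. fscale emb (u v) v)"
      using fs.span_finite[of "(\<lambda>b. w\<^sub>0 (y b)) ` B"] B(4) by auto
    also have "\<dots> = (\<Sum>b\<in>B. fscale emb (u (w\<^sub>0 (y b))) (w\<^sub>0 (y b)))"
      by (simp add: sum.reindex[OF ind(1)])
    also have "\<dots> = (\<Sum>b\<in>B. (emb (u (w\<^sub>0 (y b))) * k b) *s b)"
      by (rule sum.cong) (use yk in \<open>simp_all add: fscale_def\<close>)
    finally show ?thesis by (rule exI[of _ "\<lambda>b. u (w\<^sub>0 (y b))"])
  qed
  \<comment> \<open>All coordinates of this sum are 1, so expanding its multiple
    \<open>w\<^sub>0 x\<close> makes every \<open>emb (g b) * k b\<close> equal to the one scalar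
    \<open>l\<close>.\<close>
  have "(\<Sum>b\<in>B. b) \<in> W"
    unfolding B(3)[symmetric] by (intro fs.span_sum fs.span_base)
  moreover have "(\<Sum>b\<in>B. b) \<noteq> 0"
  proof
    assume "(\<Sum>b\<in>B. b) = 0"
    moreover obtain b where "b \<in> B" using B(5) t_pos by fastforce
    ultimately show False using vec_zero[of "\<lambda>_. 1" b] by simp
  qed
  ultimately obtain x l where xl: "l \<noteq> 0" "w\<^sub>0 x = l *s (\<Sum>b\<in>B. b)" using mult by blast
  obtain g where g: "w\<^sub>0 x = (\<Sum>b\<in>B. (emb (g b) * k b) *s b)" using expand by blast
  define c where "c = inverse l"
  have c: "c \<noteq> 0" using xl by (simp add: c_def)
  have "b = c *s w\<^sub>0 (emb (g b) * y b)" if "b \<in> B" for b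
  proof -
    have "(\<Sum>b\<in>B. (emb (g b) * k b - l) *s b) = 0"
      using g xl(2) by (simp add: vec.scale_left_diff_distrib sum_subtractf vec.scale_sum_right)
    then have "emb (g b) * k b - l = 0" using that by (rule vec_zero)
    then have "emb (g b) * k b = l" by simp
    then have "c *s w\<^sub>0 (emb (g b) * y b) = (c * l) *s b"
      using yk[OF that] by (simp add: scale mult.assoc)
    then show ?thesis using xl by (simp add: c_def)
  qed
  then have "B \<subseteq> range (\<lambda>x. c *s w\<^sub>0 x)" by blast
  moreover have "fs.subspace (range (\<lambda>x. c *s w\<^sub>0 x))"
    unfolding fs.subspace_def
  proof (intro conjI ballI allI)
    show "0 \<in> range (\<lambda>x. c *s w\<^sub>0 x)" by (rule range_eqI[of _ _ 0]) (simp add: w\<^sub>0_0)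
    show "u + v \<in> range (\<lambda>x. c *s w\<^sub>0 x)" if "u \<in> range (\<lambda>x. c *s w\<^sub>0 x)" "v \<in> range (\<lambda>x. c *s w\<^sub>0 x)" for u v
      using that by (auto simp flip: vec.scale_right_distrib add)
    show "fscale emb e u \<in> range (\<lambda>x. c *s w\<^sub>0 x)" if u: "u \<in> range (\<lambda>x. c *s w\<^sub>0 x)" for e u
    proof -
      obtain x where "u = c *s w\<^sub>0 x" using u by auto
      then have "fscale emb e u = c *s w\<^sub>0 (emb e * x)"
        by (simp add: fscale_def scale mult.commute[of c])
      then show ?thesis by blast
    qed
  qed
  ultimately have "W \<subseteq> range (\<lambda>x. c *s w\<^sub>0 x)"
    using fs.span_minimal B(3) by blast
  moreover have "card (range (\<lambda>x. c *s w\<^sub>0 x)) \<le> card W"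
    using card_image_le[of UNIV "\<lambda>x. c *s w\<^sub>0 x"] card_W card_k by simp
  ultimately have "W = range (\<lambda>x. c *s w\<^sub>0 x)" by (intro card_seteq) auto
  then show thesis using that c by blast
qed

end

section \<open>Linear sets of pseudoregulus type\<close>

lemma from_coords_add: "from_coords e (\<lambda>i. x i + y i) = from_coords e x + from_coords e y"
  by (simp add: from_coords_def vec.scale_left_distrib sum.distrib)

lemma from_coords_scale: "from_coords e (\<lambda>i. c * x i) = c *s from_coords e x"
  by (simp add: from_coords_def vec.scale_sum_right)

lemma from_coords_eq_0D:
  fixes e :: "nat \<Rightarrow> 'k::field ^ 'n"
  assumes e: "coordinate_basis e" and zero: "from_coords e x = 0" and i: "i \<in> {1..CARD('n)}"
  shows "x i = 0"
proof -
  let ?I = "{1..CARD('n)}"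
  have inj: "inj_on e ?I" and ind: "vec.independent (e ` ?I)"
    using e by (auto simp: coordinate_basis_def)
  define g where "g v = x (inv_into ?I e v)" for v
  have "(\<Sum>v\<in>e ` ?I. g v *s v) = (\<Sum>i\<in>?I. g (e i) *s e i)"
    using sum.reindex[OF inj, of "\<lambda>v. g v *s v"] by (simp only: comp_def)
  also have "\<dots> = from_coords e x"
    unfolding from_coords_def g_def by (rule sum.cong) (simp_all only: inv_into_f_f[OF inj])
  finally have "g (e i) = 0"
    using zero i by (intro vec.independentD[OF ind _ subset_refl]) auto
  then show ?thesis unfolding g_def inv_into_f_f[OF inj i] .
qed

lemma line_coords_add: "line_coords e (u + v) = line_coords e u + line_coords e v"
  by (simp add: line_coords_def vec.scale_left_distrib)

lemma line_coords_scale: "line_coords e (c *s u) = c *s line_coords e u"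
  by (simp add: line_coords_def vec.scale_right_distrib)

lemma line_coords_conv_from_coords:
  fixes e :: "nat \<Rightarrow> 'k::field ^ 'n"
  assumes "CARD('n) \<ge> 2"
  shows "line_coords e (vector [x (CARD('n) - 1), x (CARD('n))]) =
    from_coords e (\<lambda>i. if i \<in> {1..CARD('n) - 2} then 0 else x i)"
proof -
  let ?n = "CARD('n)"
  have "?n - 1 \<noteq> ?n" using assms by simp
  have "from_coords e (\<lambda>i. if i \<in> {1..?n - 2} then 0 else x i) = (\<Sum>i\<in>{?n - 1, ?n}. x i *s e i)"
    unfolding from_coords_def
    by (rule sum.mono_neutral_cong_right) (use assms in auto)
  then show ?thesis
    using \<open>?n - 1 \<noteq> ?n\<close> by (simp add: line_coords_def)
qed

lemma inj_line_coords:
  fixes e :: "nat \<Rightarrow> 'k::field ^ 'n"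
  assumes e: "coordinate_basis e" and n: "CARD('n) \<ge> 2"
  shows "inj (line_coords e)"
proof (rule injI)
  fix u v assume uv: "line_coords e u = line_coords e v"
  define x where "x i = (if i = CARD('n) - 1 then (u - v) $ 1 else (u - v) $ 2)" for i
  have x: "x (CARD('n) - 1) = (u - v) $ 1" "x (CARD('n)) = (u - v) $ 2"
    using n by (auto simp: x_def)
  then have "vector [x (CARD('n) - 1), x (CARD('n))] = u - v"
    by (simp add: vec_eq_iff forall_2)
  then have "from_coords e (\<lambda>i. if i \<in> {1..CARD('n) - 2} then 0 else x i) = line_coords e (u - v)"
    using line_coords_conv_from_coords[OF n, of e x] by simp
  also have "\<dots> = 0"
    using line_coords_add[of e "u - v" v] uv by simp
  finally have "i \<in> {1..CARD('n)} \<Longrightarrow> i \<notin> {1..CARD('n) - 2} \<Longrightarrow> x i = 0" for i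
    using from_coords_eq_0D[OF e, of "\<lambda>i. if i \<in> {1..CARD('n) - 2} then 0 else x i" i] by auto
  moreover have "CARD('n) - 1 \<in> {1..CARD('n)}" "CARD('n) - 1 \<notin> {1..CARD('n) - 2}"
    "CARD('n) \<in> {1..CARD('n)}" "CARD('n) \<notin> {1..CARD('n) - 2}"
    using n by auto
  ultimately have "x (CARD('n) - 1) = 0" "x (CARD('n)) = 0" by blast+
  then have "(u - v) $ 1 = 0" "(u - v) $ 2 = 0"
    by (simp_all only: x)
  then show "u = v" by (simp add: vec_eq_iff forall_2)
qed

section \<open>Parametrisation of the subgeometry by the large field\<close>

context finite_field_extension
begin

text \<open>In the coordinates given by \<open>\<phi>\<close>, nonzero vectors of \<open>W\<close>
  project to multiples of (l, l^q), so their two coordinates have equal norm. The first coordinate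
  identifies \<open>W\<close> with the field, which turns the second into a norm-preserving linear
  map \<open>x \<mapsto> a * frob q s x\<close>; the factor \<open>a\<close> is absorbed into
  \<open>\<psi>\<close>.\<close>

lemma pseudoregulus_representation:
  fixes W G M :: "('k ^ 'n) set"
  assumes "t \<le> q"
    and W: "fsubspace emb W" "fdim emb W = t"
    and p: "\<And>x y. p (x + y) = p x + p y" "\<And>c x. p (c *s x) = c *s p x"
      "\<And>x. p x \<in> M" "\<And>x. x - p x \<in> G"
    and proj: "\<And>x. proj_from G M (vec.span {x}) = vec.span {p x}"
    and disj: "kpoints W \<inter> kpoints G = {}"
    and L: "L = proj_from G M ` kpoints W" and "pseudoregulus_type q M L"
  obtains s w \<psi> where "coprime s t"
    and "\<forall>x y. w (x + y) = w x + w y" and "\<forall>c x. w (emb c * x) = emb c *s w x"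
    and "inj w" and "range w = W"
    and "\<forall>u v :: 'k ^ 2. \<psi> (u + v) = \<psi> u + \<psi> v" and "\<forall>c u. \<psi> (c *s u) = c *s \<psi> u"
    and "inj \<psi>" and "range \<psi> = M"
    and "\<forall>x. p (w x) = \<psi> (vector [x, frob q s x])"
proof -
  interpret fs: vector_space "fscale emb :: 'f \<Rightarrow> 'k ^ 'n \<Rightarrow> 'k ^ 'n"
    by (rule vector_space_fscale[OF emb])
  obtain \<phi> where \<phi>: "line_iso \<phi> M" and L_\<phi>: "L = (`) \<phi> ` {vec.span {vector [l, l ^ q]} | l. l \<noteq> 0}"
    using \<open>pseudoregulus_type q M L\<close> by (auto simp: pseudoregulus_type_def)
  note \<phi>_add = line_isoD(1)[OF \<phi>] and \<phi>_scale = line_isoD(2)[OF \<phi>]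
    and inj_\<phi> = line_isoD(3)[OF \<phi>] and range_\<phi> = line_isoD(4)[OF \<phi>]
  define \<rho> where "\<rho> x = inv_into UNIV \<phi> (p x)" for x
  have \<phi>_\<rho>: "\<phi> (\<rho> x) = p x" for x
    unfolding \<rho>_def using p(3) range_\<phi> by (intro f_inv_into_f) simp
  have \<rho>_add: "\<rho> (x + y) = \<rho> x + \<rho> y" for x y
    by (rule injD[OF inj_\<phi>]) (simp add: \<phi>_add \<phi>_\<rho> p(1))
  have \<rho>_scale: "\<rho> (c *s x) = c *s \<rho> x" for c x
    by (rule injD[OF inj_\<phi>]) (simp add: \<phi>_scale \<phi>_\<rho> p(2))
  have \<rho>_W: "\<exists>k l. k \<noteq> 0 \<and> l \<noteq> 0 \<and> \<rho> x = vector [k * l, k * l ^ q]" if x: "x \<in> W" "x \<noteq> 0" for x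
  proof -
    have span_x: "vec.span {x} \<in> kpoints W" using x by (auto simp: kpoints_def)
    then have "vec.span {p x} \<in> L" unfolding L proj[symmetric] by (rule imageI)
    then obtain l where l: "l \<noteq> 0" "vec.span {p x} = \<phi> ` vec.span {vector [l, l ^ q]}"
      unfolding L_\<phi> by blast
    then have "vec.span {p x} = vec.span {\<phi> (vector [l, l ^ q])}"
      by (simp add: image_span_singleton \<phi>_scale)
    then obtain k where k: "p x = k *s \<phi> (vector [l, l ^ q])" by (rule span_singleton_eqD)
    have "p x \<noteq> 0"
    proof
      assume "p x = 0"
      then have "x \<in> G" using p(4)[of x] by simp
      then have "vec.span {x} \<in> kpoints G" using x(2) by (auto simp: kpoints_def)
      then show False using span_x disj by blast
    qed
    then have "k \<noteq> 0" using k by auto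
    moreover have "\<rho> x = vector [k * l, k * l ^ q]"
      by (rule injD[OF inj_\<phi>]) (simp add: \<phi>_\<rho> k flip: \<phi>_scale scale_vector_2)
    ultimately show ?thesis using l(1) by blast
  qed
  define g where "g x = \<rho> x $ 1" for x
  have g_add: "g (x + y) = g x + g y" and g_scale: "g (c *s x) = c * g x" for x y c
    by (simp_all add: g_def \<rho>_add \<rho>_scale)
  have g_inj: "inj_on g W"
  proof (rule inj_onI, rule ccontr)
    fix x y assume xy: "x \<in> W" "y \<in> W" "g x = g y" "x \<noteq> y"
    then have "x - y \<in> W" "x - y \<noteq> 0" using fs.subspace_diff[OF W(1)] by auto
    then obtain k l where "k \<noteq> 0" "l \<noteq> 0" "\<rho> (x - y) = vector [k * l, k * l ^ q]"
      using \<rho>_W by blast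
    then have "g (x - y) \<noteq> 0" by (simp add: g_def)
    then show False using g_add[of "x - y" y] xy(3) by simp
  qed
  have card_W: "card W = q ^ t"
    by (rule fdim_subspace_basis[OF W t_pos])
  \<comment> \<open>An injective map between sets of size \<open>q ^ t\<close> is onto, so the first
    coordinate has an inverse \<open>w\<close>.\<close>
  then have g_W: "g ` W = UNIV"
    using card_image[OF g_inj] card_k by (intro card_seteq) auto
  define w where "w = inv_into W g"
  have w_W: "w x \<in> W" for x unfolding w_def using g_W by (intro inv_into_into) simp
  have g_w: "g (w x) = x" for x unfolding w_def using g_W by (intro f_inv_into_f) simp
  have w_eqI: "w x = y" if "y \<in> W" "g y = x" for x y
    using inj_onD[OF g_inj, of "w x" y] that w_W g_w by simp
  have w_add: "w (x + y) = w x + w y" for x y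
    by (rule w_eqI) (simp_all add: fs.subspace_add[OF W(1)] w_W g_add g_w)
  have w_scale: "w (emb c * x) = emb c *s w x" for c x
    using fs.subspace_scale[OF W(1) w_W, of c x]
    by (intro w_eqI) (simp_all add: fscale_def g_scale g_w)
  have w_inj: "inj w" by (rule inj_on_inverseI[of _ g]) (rule g_w)
  have w_zero: "x = 0" if "w x = 0" for x
    using g_w[of x] that g_scale[of 0 0] by simp
  have w_range: "range w = W"
  proof (intro equalityI subsetI)
    fix x assume "x \<in> W"
    then have "w (g x) = x" by (rule w_eqI) simp
    then show "x \<in> range w" by (metis rangeI)
  qed (use w_W in auto)
  define f where "f x = \<rho> (w x) $ 2" for x
  have \<rho>_w: "\<rho> (w x) = vector [x, f x]" for x
    using g_w[of x] by (simp add: vec_eq_iff forall_2 g_def f_def)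
  have norm_f: "norm_q q t (f x) = norm_q q t x" for x
  proof (cases "x = 0")
    case True
    then have "w x = 0" using w_add[of 0 0] by simp
    then show ?thesis using True \<rho>_scale[of 0 0] by (simp add: f_def)
  next
    case False
    then have "w x \<noteq> 0" using w_zero by blast
    then obtain k l where "k \<noteq> 0" "l \<noteq> 0" "\<rho> (w x) = vector [k * l, k * l ^ q]"
      using \<rho>_W w_W by blast
    then have "x = k * l" "f x = k * frob q 1 l"
      unfolding \<rho>_w vector_2_eq_iff by (auto simp: frob_def)
    then show ?thesis by (simp add: norm_q_mult)
  qed
  have "\<exists>s a. norm_q q t a = 1 \<and> (\<forall>x. f x = a * frob q s x)"
    by (rule norm_preserving_linear[OF \<open>t \<le> q\<close> _ _ norm_f])
       (simp_all add: f_def w_add w_scale \<rho>_add \<rho>_scale)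
  then obtain s a where a: "norm_q q t a = 1" and f: "\<And>x. f x = a * frob q s x" by blast
  have "a \<noteq> 0" using a norm_q_eq_0[of a] by auto
  define D where "D u = (vector [u $ 1, a * u $ 2] :: 'k ^ 2)" for u :: "'k ^ 2"
  define \<psi> where "\<psi> u = \<phi> (D u)" for u
  have D_add: "D (u + v) = D u + D v" and D_scale: "D (c *s u) = c *s D u" for u v c
    by (simp_all add: D_def vec_eq_iff forall_2 algebra_simps)
  have "inj D"
    using \<open>a \<noteq> 0\<close> by (auto simp: inj_on_def D_def vec_eq_iff forall_2)
  have "surj D"
  proof (rule surjI)
    show "D (vector [u $ 1, u $ 2 / a]) = u" for u
      using \<open>a \<noteq> 0\<close> by (simp add: D_def vec_eq_iff forall_2)
  qed
  have \<psi>: "p (w x) = \<psi> (vector [x, frob q s x])" for x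
    unfolding \<phi>_\<rho>[symmetric] \<rho>_w by (simp add: \<psi>_def D_def f)
  have "inj \<psi>"
    unfolding \<psi>_def using inj_\<phi> \<open>inj D\<close> by (auto simp: inj_on_def)
  have "range \<psi> = M"
    unfolding \<psi>_def range_\<phi>[symmetric] using \<open>surj D\<close> by (metis image_image)
  \<comment> \<open>The slopes of the points of \<open>L\<close> are \<open>a\<close> times the
    ratios in \<open>?S\<close>; by the normal form they are also all the l^q / l, that is, all
    elements of norm 1. So \<open>?S\<close> has the size that forces coprimality.\<close>
  have "coprime s t"
  proof (rule coprime_of_card_frob_ratio)
    let ?S = "(\<lambda>x :: 'k. frob q s x / x) ` (- {0})"
    have "(\<lambda>y. a * y) ` ?S = {y. norm_q q t y = 1}"
    proof (intro equalityI subsetI)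
      fix y assume "y \<in> (\<lambda>y. a * y) ` ?S"
      then show "y \<in> {y. norm_q q t y = 1}"
        using a by (auto simp: norm_q_mult norm_q_divide split: if_splits)
    next
      fix y :: 'k assume "y \<in> {y. norm_q q t y = 1}"
      then have "y \<in> (\<lambda>x. frob q 1 x / x) ` (- {0})"
        using frob_ratio_norm_one[of 1] by simp
      then obtain l where l: "l \<noteq> 0" "y = l ^ q / l" by (auto simp: frob_def)
      have "\<phi> ` vec.span {vector [l, l ^ q]} \<in> L" unfolding L_\<phi> using l(1) by blast
      then obtain v where v: "v \<in> W" "v \<noteq> 0" "\<phi> ` vec.span {vector [l, l ^ q]} = proj_from G M (vec.span {v})"
        unfolding L kpoints_def by blast
      then obtain x where x: "v = w x" using w_range by blast
      have "p v = \<phi> (vector [x, f x])" unfolding x \<phi>_\<rho>[symmetric] \<rho>_w ..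
      then have "vec.span {\<phi> (vector [l, l ^ q])} = vec.span {\<phi> (vector [x, f x])}"
        using v(3) by (simp add: proj image_span_singleton \<phi>_scale)
      then obtain k where "\<phi> (vector [l, l ^ q]) = k *s \<phi> (vector [x, f x])"
        by (rule span_singleton_eqD)
      then have "vector [l, l ^ q] = (vector [k * x, k * f x] :: 'k ^ 2)"
        by (intro injD[OF inj_\<phi>]) (simp flip: \<phi>_scale scale_vector_2)
      then have kx: "l = k * x" "l ^ q = k * f x" by (auto simp: vector_2_eq_iff)
      then have "y = a * (frob q s x / x)" using l by (auto simp: f)
      moreover have "x \<noteq> 0" using kx l(1) by auto
      ultimately show "y \<in> (\<lambda>y. a * y) ` ?S" by blast
    qed
    moreover have "card ((\<lambda>y. a * y) ` ?S) = card ?S"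
      using \<open>a \<noteq> 0\<close> by (intro card_image) (auto simp: inj_on_def)
    ultimately show "card ?S = card {y :: 'k. norm_q q t y = 1}" by simp
  qed
  have \<psi>_add: "\<psi> (u + v) = \<psi> u + \<psi> v" and \<psi>_scale: "\<psi> (c *s u) = c *s \<psi> u" for u v c
    by (simp_all add: \<psi>_def D_add D_scale \<phi>_add \<phi>_scale)
  show thesis
    by (rule that[of s w \<psi>])
       (simp_all add: \<open>coprime s t\<close> w_add w_scale w_inj w_range \<psi>_add \<psi>_scale \<open>inj \<psi>\<close> \<open>range \<psi> = M\<close> \<psi>)
qed

text \<open>The vectors \<open>(b, d)\<close> and \<open>(a, c)\<close> correspond to the standard
  basis. Each point of \<open>r\<close> is spanned by a pair \<open>(x, frob q s x)\<close>, so its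
  coordinates have equal norm, and the norm comparison makes \<open>c / d\<close> a conjugate of
  \<open>a / b\<close>.\<close>

lemma conjugate_form_of_subline:
  fixes M :: "('k ^ 'n) set" and \<psi> :: "'k ^ 2 \<Rightarrow> 'k ^ 'n"
  assumes "t \<le> q"
    and \<psi>: "\<And>u v. \<psi> (u + v) = \<psi> u + \<psi> v" "\<And>c u. \<psi> (c *s u) = c *s \<psi> u" "inj \<psi>" "range \<psi> = M"
    and "subline emb M r"
    and sub: "\<And>X. X \<in> r \<Longrightarrow> \<exists>x. x \<noteq> 0 \<and> X = \<psi> ` vec.span {vector [x, frob q s x]}"
  obtains a b c d h where "b \<noteq> 0" "d \<noteq> 0" "norm_q q t b = norm_q q t d"
    "c / d = frob q h (a / b)" "c / d \<noteq> a / b"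
    "r = (`) \<psi> ` {vec.span {vector [emb i * b + emb j * a, emb i * d + emb j * c]} | i j. (i, j) \<noteq> (0, 0)}"
proof -
  obtain \<phi> where \<phi>: "line_iso \<phi> M"
    and r: "r = (`) \<phi> ` {vec.span {vector [emb i, emb j]} | i j. (i, j) \<noteq> (0, 0)}"
    using \<open>subline emb M r\<close> by (auto simp: subline_def)
  have "\<exists>u. \<phi> v = \<psi> u" for v
    using line_isoD(4)[OF \<phi>] \<psi>(4) by blast
  then obtain u\<^sub>1 u\<^sub>2 where u: "\<phi> (vector [1, 0]) = \<psi> u\<^sub>1" "\<phi> (vector [0, 1]) = \<psi> u\<^sub>2" by metis
  define b where "b = u\<^sub>1 $ 1"
  define d where "d = u\<^sub>1 $ 2"
  define a where "a = u\<^sub>2 $ 1"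
  define c where "c = u\<^sub>2 $ 2"
  define pt where "pt i j = (vector [emb i * b + emb j * a, emb i * d + emb j * c] :: 'k ^ 2)" for i j
  have \<phi>_pt: "\<phi> (vector [emb i, emb j]) = \<psi> (pt i j)" for i j
  proof -
    have "vector [emb i, emb j] = emb i *s vector [1, 0] + emb j *s (vector [0, 1] :: 'k ^ 2)"
      by (simp add: vec_eq_iff forall_2)
    then have "\<phi> (vector [emb i, emb j]) = \<psi> (emb i *s u\<^sub>1 + emb j *s u\<^sub>2)"
      by (simp only: line_isoD(1,2)[OF \<phi>] u \<psi>(1,2))
    moreover have "emb i *s u\<^sub>1 + emb j *s u\<^sub>2 = pt i j"
      by (simp add: pt_def vec_eq_iff forall_2 a_def b_def c_def d_def)
    ultimately show ?thesis by simp
  qed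
  have image_pt: "\<phi> ` vec.span {vector [emb i, emb j]} = \<psi> ` vec.span {pt i j}" for i j
    by (simp add: image_span_singleton line_isoD(2)[OF \<phi>] \<psi>(2) \<phi>_pt)
  have r_pt: "r = (`) \<psi> ` {vec.span {pt i j} | i j. (i, j) \<noteq> (0, 0)}"
  proof -
    have "r = {\<phi> ` vec.span {vector [emb i, emb j]} | i j. (i, j) \<noteq> (0, 0)}" unfolding r by blast
    also have "\<dots> = {\<psi> ` vec.span {pt i j} | i j. (i, j) \<noteq> (0, 0)}" unfolding image_pt ..
    finally show ?thesis by blast
  qed
  have pt: "emb i * b + emb j * a \<noteq> 0 \<and>
      norm_q q t (emb i * b + emb j * a) = norm_q q t (emb i * d + emb j * c)"
    if ij: "(i, j) \<noteq> (0, 0)" for i j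
  proof -
    have "\<psi> ` vec.span {pt i j} \<in> r" unfolding r_pt using ij by blast
    then obtain x where x: "x \<noteq> 0" "\<psi> ` vec.span {pt i j} = \<psi> ` vec.span {vector [x, frob q s x]}"
      using sub by blast
    then have eq: "vec.span {pt i j} = vec.span {vector [x, frob q s x]}"
      using \<psi>(3) by (simp add: inj_image_eq_iff)
    obtain k where k: "pt i j = k *s vector [x, frob q s x]" using eq by (rule span_singleton_eqD)
    obtain k' where k': "vector [x, frob q s x] = k' *s pt i j" using eq[symmetric] by (rule span_singleton_eqD)
    have "x = k' * (emb i * b + emb j * a)"
      using k' by (simp add: pt_def scale_vector_2 vector_2_eq_iff)
    moreover have "emb i * b + emb j * a = k * x" "emb i * d + emb j * c = k * frob q s x"
      using k by (simp_all add: pt_def scale_vector_2 vector_2_eq_iff)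
    ultimately show ?thesis using x(1) by (auto simp: norm_q_mult)
  qed
  have b: "b \<noteq> 0" "norm_q q t b = norm_q q t d" using pt[of 1 0] by auto
  then have "d \<noteq> 0" by (metis norm_q_eq_0)
  have "\<exists>h<t. c / d = frob q h (a / b)"
    using b \<open>d \<noteq> 0\<close> \<open>t \<le> q\<close> pt[of _ 1] by (intro norm_eq_imp_conjugate) (auto simp: add.commute)
  then obtain h where h: "c / d = frob q h (a / b)" by blast
  have neq: "c / d \<noteq> a / b"
  proof
    assume "c / d = a / b"
    then have "u\<^sub>2 = (a / b) *s u\<^sub>1"
      using b(1) \<open>d \<noteq> 0\<close> by (simp add: vec_eq_iff forall_2 flip: a_def b_def c_def d_def) (simp add: field_simps)
    then have "\<phi> (vector [0, 1]) = \<phi> ((a / b) *s vector [1, 0])"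
      by (simp only: u line_isoD(2)[OF \<phi>] \<psi>(2))
    then have "vector [0, 1] = (a / b) *s (vector [1, 0] :: 'k ^ 2)"
      by (rule injD[OF line_isoD(3)[OF \<phi>]])
    then show False by (simp add: scale_vector_2 vector_2_eq_iff)
  qed
  from b(1) \<open>d \<noteq> 0\<close> b(2) h neq r_pt[unfolded pt_def] show thesis by (rule that)
qed

text \<open>Only the points of \<open>W\<close> are given, and they are those of the explicit space
  of the vectors \<open>w\<^sub>0 l\<close>. So \<open>W\<close> is a scalar multiple of that space,
  and the scalar changes no projected point.\<close>

lemma standard_position_representation:
  fixes W G M :: "('k ^ 'n) set"
  assumes W: "canonical_subgeometry_space emb W" and t: "CARD('n) = t" "t \<ge> 2"
    and std: "standard_position q \<nu> e (kpoints W) G M"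
    and p: "\<And>x y. p (x + y) = p x + p y" "\<And>c x. p (c *s x) = c *s p x"
      "\<And>x y. x \<in> G \<Longrightarrow> y \<in> M \<Longrightarrow> p (x + y) = y"
    and proj: "\<And>x. proj_from G M (vec.span {x}) = vec.span {p x}"
  obtains w where "\<forall>x y. w (x + y) = w x + w y" and "\<forall>c x. w (emb c * x) = emb c *s w x"
    and "inj w" and "range w = W"
    and "\<forall>x. proj_from G M (vec.span {w x}) = line_coords e ` vec.span {vector [x, frob q \<nu> x]}"
proof -
  have e: "coordinate_basis e"
    and pts: "kpoints W = {vec.span {from_coords e (\<lambda>i. (frob q \<nu> ^^ (i - 1)) l)} | l. l \<noteq> 0}"
    and G: "G = {from_coords e x | x. x (CARD('n) - 1) = 0 \<and> x (CARD('n)) = 0}"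
    and M: "M = {from_coords e x | x. \<forall>i\<in>{1..CARD('n) - 2}. x i = 0}"
    using std by (auto simp: standard_position_def)
  define w\<^sub>0 where "w\<^sub>0 l = from_coords e (\<lambda>i. frob q (\<nu> * (i - 1)) l)" for l
  have w\<^sub>0_add: "w\<^sub>0 (x + y) = w\<^sub>0 x + w\<^sub>0 y" for x y
    by (simp add: w\<^sub>0_def frob_add from_coords_add)
  have w\<^sub>0_scale: "w\<^sub>0 (emb c * x) = emb c *s w\<^sub>0 x" for c x
    by (simp add: w\<^sub>0_def frob_mult from_coords_scale)
  have w\<^sub>0_zero: "x = 0" if "w\<^sub>0 x = 0" for x
    using from_coords_eq_0D[OF e that[unfolded w\<^sub>0_def], of 1] t by simp
  have p_w\<^sub>0: "p (w\<^sub>0 l) = line_coords e (vector [frob q (\<nu> * (t - 2)) l, frob q (\<nu> * (t - 1)) l])" for l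
  proof -
    define x where "x i = frob q (\<nu> * (i - 1)) l" for i
    \<comment> \<open>Splitting off the first \<open>t - 2\<close> coordinates decomposes the vector
      along \<open>G\<close> and \<open>M\<close>.\<close>
    define y where "y i = (if i \<in> {1..t - 2} then x i else 0)" for i
    define z where "z i = (if i \<in> {1..t - 2} then 0 else x i)" for i
    have "from_coords e y \<in> G" unfolding G
      using t by (intro CollectI exI[of _ y]) (auto simp: y_def)
    moreover have "from_coords e z \<in> M" unfolding M
      using t by (intro CollectI exI[of _ z]) (auto simp: z_def)
    moreover have "w\<^sub>0 l = from_coords e y + from_coords e z"
      unfolding from_coords_add[symmetric] w\<^sub>0_def
      by (rule arg_cong[of _ _ "from_coords e"]) (auto simp: x_def y_def z_def)
    ultimately have "p (w\<^sub>0 l) = from_coords e z" using p(3) by simp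
    also have "\<dots> = line_coords e (vector [x (t - 1), x t])"
      using line_coords_conv_from_coords[of e x, unfolded t(1), OF t(2)] unfolding z_def[abs_def] by simp
    finally show ?thesis using t by (simp add: x_def numeral_2_eq_2)
  qed
  have pts_w\<^sub>0: "kpoints W = {vec.span {w\<^sub>0 l} | l. l \<noteq> 0}"
    unfolding pts by (simp add: w\<^sub>0_def frob_funpow)
  obtain c where c: "c \<noteq> 0" "W = range (\<lambda>x. c *s w\<^sub>0 x)"
    by (rule canonical_subgeometry_space_unique[OF W t(1) w\<^sub>0_add w\<^sub>0_scale w\<^sub>0_zero pts_w\<^sub>0])
  \<comment> \<open>The shift by \<open>\<sigma>\<^sup>2\<close> turns the last two coordinates into \<open>(x, x\<^sup>\<sigma>)\<close>, as \<open>\<sigma>\<^sup>t\<close> is the identity.\<close>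
  define w where "w x = c *s w\<^sub>0 (frob q (\<nu> * 2) x)" for x
  show thesis
  proof (rule that[of w])
    show "\<forall>x y. w (x + y) = w x + w y"
      by (simp add: w_def frob_add w\<^sub>0_add vec.scale_right_distrib)
    show "\<forall>a x. w (emb a * x) = emb a *s w x"
      by (simp add: w_def frob_mult w\<^sub>0_scale mult.commute)
    show "inj w"
    proof (rule injI)
      fix x y assume "w x = w y"
      then have "w\<^sub>0 (frob q (\<nu> * 2) x) = w\<^sub>0 (frob q (\<nu> * 2) y)" using c(1) by (simp add: w_def)
      then have "w\<^sub>0 (frob q (\<nu> * 2) (x - y)) = 0"
        using w\<^sub>0_add[of "frob q (\<nu> * 2) (x - y)" "frob q (\<nu> * 2) y"] by (simp add: frob_diff)
      then have "frob q (\<nu> * 2) (x - y) = 0" by (rule w\<^sub>0_zero)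
      then show "x = y" by simp
    qed
    have "range w = (\<lambda>x. c *s w\<^sub>0 x) ` range (frob q (\<nu> * 2))"
      by (simp add: w_def image_image)
    then show "range w = W" using bij_frob[of "\<nu> * 2"] c(2) by (simp add: bij_def)
    show "\<forall>x. proj_from G M (vec.span {w x}) = line_coords e ` vec.span {vector [x, frob q \<nu> x]}"
    proof
      fix x :: 'k
      obtain m where m: "t = m + 2" using t(2) by (metis add.commute le_Suc_ex)
      have "\<nu> * (t - 2) + \<nu> * 2 = t * \<nu>" "\<nu> * (t - 1) + \<nu> * 2 = \<nu> + t * \<nu>"
        unfolding m by (simp_all add: algebra_simps)
      then have "frob q (\<nu> * (t - 2)) (frob q (\<nu> * 2) x) = frob q (t * \<nu>) x"
        and "frob q (\<nu> * (t - 1)) (frob q (\<nu> * 2) x) = frob q \<nu> (frob q (t * \<nu>) x)"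
        unfolding frob_frob by (simp_all only:)
      then have "p (w x) = c *s line_coords e (vector [x, frob q \<nu> x])"
        by (simp add: w_def p(2) p_w\<^sub>0)
      then show "proj_from G M (vec.span {w x}) = line_coords e ` vec.span {vector [x, frob q \<nu> x]}"
        using c(1) by (simp add: proj span_singleton_scale image_span_singleton line_coords_scale)
    qed
  qed
qed

section \<open>Transversal lines read over the large field\<close>

lemma fspan_singleton_eqD:
  assumes "fspan emb {x} = fspan emb {y :: 'k ^ 'm}"
  obtains c where "x = emb c *s y"
proof -
  interpret fs: vector_space "fscale emb :: 'f \<Rightarrow> 'k ^ 'm \<Rightarrow> 'k ^ 'm"
    by (rule vector_space_fscale[OF emb])
  have "x \<in> fspan emb {y}" using fs.span_base[of x "{x}"] assms by simp
  then show ?thesis using that by (auto simp: fs.span_singleton fscale_def)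
qed

text \<open>A vector of \<open>T\<close> in the field reduction of \<open>X\<close> is a multiple of
  a vector spanning \<open>X\<close>, so it spans \<open>X\<close> itself over the large
  field.\<close>

lemma transversal_line_points:
  assumes T: "transversal_line emb R T" and R: "R \<subseteq> kpoints UNIV"
  shows "R \<subseteq> kpoints T"
proof
  fix X assume X: "X \<in> R"
  then obtain u where u: "X = vec.span {u}" "u \<noteq> 0" using R by (auto simp: kpoints_def)
  define a where "a = u $ 1"
  define b where "b = u $ 2"
  have u_ab: "u = vector [a, b]" by (simp add: a_def b_def vec_eq_iff forall_2)
  then have "(a, b) \<noteq> (0, 0)" using u(2) vector_2_eq_0_iff by auto
  then have "fpoints emb T \<inter> field_reduction emb a b \<noteq> {}"
    using T X u(1) u_ab by (auto simp: transversal_line_def)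
  then obtain \<tau> z where \<tau>: "\<tau> \<in> T" "\<tau> \<noteq> 0" "fspan emb {\<tau>} = fspan emb {vector [z * a, z * b]}"
    by (auto simp: fpoints_def field_reduction_def)
  obtain c where "\<tau> = emb c *s vector [z * a, z * b]" using \<tau>(3) by (rule fspan_singleton_eqD)
  then have "\<tau> = (emb c * z) *s u" by (simp add: u_ab scale_vector_2 mult.assoc)
  then have "X = vec.span {\<tau>}" using \<tau>(2) u(1) by (auto simp: span_singleton_scale)
  then show "X \<in> kpoints T" using \<tau> by (auto simp: kpoints_def)
qed

text \<open>The representative in \<open>S_set\<close> is only proportional to
  \<open>\<tau>\<close>; the shape persists because \<open>frob q h\<close> commutes with ground
  field scalars.\<close>

lemma fpoints_subset_S_setD:
  assumes "fpoints emb T \<subseteq> S_set emb h k" "\<tau> \<in> T" "\<tau> \<noteq> 0"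
  shows "\<exists>z. z \<noteq> 0 \<and> \<tau> = vector [z, k * frob q h z]"
proof -
  have "fspan emb {\<tau>} \<in> S_set emb h k" using assms by (auto simp: fpoints_def)
  then obtain z where z: "fspan emb {\<tau>} = fspan emb {vector [z, k * frob q h z]}"
    by (auto simp: S_set_def frob_def card_f)
  obtain c where "\<tau> = emb c *s vector [z, k * frob q h z]" using z by (rule fspan_singleton_eqD)
  then have \<tau>: "\<tau> = vector [emb c * z, k * frob q h (emb c * z)]"
    by (simp add: scale_vector_2 frob_mult mult.left_commute)
  moreover have "emb c * z \<noteq> 0" using \<tau> assms(3) vector_2_eq_0_iff by fastforce
  ultimately show ?thesis by blast
qed

end

section \<open>The curve without coordinates, and its order in given coordinates\<close>

theorem theorem5p12:
  fixes emb :: "'f::field \<Rightarrow> 'k::field"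
    and q t :: nat
    and W G M :: "('k ^ 'n) set"
    and \<Sigma> L r :: "('k ^ 'n) set set"
  assumes "CARD('f) = q" and "CARD('k) = q ^ t" and "field_embedding emb"
    and "CARD('n) = t" and "t \<ge> 3" and "q \<ge> t"
    and "canonical_subgeometry_space emb W" and "\<Sigma> = kpoints W"
    and "vec.subspace G" and "vec.dim G = t - 2"
    and "vec.subspace M" and "vec.dim M = 2"
    and "\<Sigma> \<inter> kpoints G = {}" and "kpoints M \<inter> kpoints G = {}"
    and "L = proj_from G M ` \<Sigma>"
    and "\<exists>n. scattered_linear_set emb n M L" and "pseudoregulus_type q M L"
    and "subline emb M r" and "r \<subseteq> L"
  shows "(\<exists>n\<ge>1. nrc_in_subgeometry emb W n (\<Sigma> \<inter> proj_preimage G M r)) \<and>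
    (\<forall>e \<nu>. coprime \<nu> t \<and> standard_position q \<nu> e \<Sigma> G M \<longrightarrow>
       L = (`) (line_coords e) ` {vec.span {vector [\<mu>, frob q \<nu> \<mu>]} | \<mu>. \<mu> \<noteq> 0} \<and>
       (\<forall>h\<in>{0..t - 1}.
          (\<exists>T. transversal_line emb {X \<in> kpoints UNIV. line_coords e ` X \<in> r} T \<and>
               (\<exists>Y\<in>S_family emb t h. fpoints emb T \<subseteq> Y)) \<longrightarrow>
          (\<exists>m n. m > 1 \<and> m dvd t \<and> 1 \<le> n \<and> n \<le> m - 1 \<and>
             [int n = int h * modular_inverse (int m) (int \<nu>)] (mod int m) \<and>
             nrc_in_subgeometry emb W n (\<Sigma> \<inter> proj_preimage G M r))))"
proof -
  interpret finite_field_extension emb q t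
    by unfold_locales (use assms in auto)
  note \<Sigma> = \<open>\<Sigma> = kpoints W\<close>
  note disj = \<open>\<Sigma> \<inter> kpoints G = {}\<close>[unfolded \<Sigma>]
  note L = \<open>L = proj_from G M ` \<Sigma>\<close>[unfolded \<Sigma>]
  have W: "fsubspace emb W" "fdim emb W = t"
    using assms(4,7) by (auto simp: canonical_subgeometry_space_def)
  have dim: "vec.dim G + vec.dim M = CARD('n)"
    using assms by simp
  obtain p where p_all: "\<forall>x y. p (x + y) = p x + p y" "\<forall>c x. p (c *s x) = c *s p x"
      "\<forall>x. p x \<in> M" "\<forall>x. x - p x \<in> G" "\<forall>x\<in>G. \<forall>y\<in>M. p (x + y) = y"
    by (rule projection_along[OF assms(9,11) dim assms(14)])
  note p = p_all[rule_format]
  note proj = proj_from_span_singleton[OF assms(9,11) p]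
  \<comment> \<open>Covers both parametrisations used below: the one from the normal form of
    \<open>L\<close> and the one from the coordinates.\<close>
  have L_eq: "L = {\<psi> ` vec.span {vector [x, frob q s x]} | x. x \<noteq> 0}"
    if "\<And>x y. w (x + y) = w x + w y" "inj w" "range w = W"
      "\<And>x. proj_from G M (vec.span {w x}) = \<psi> ` vec.span {vector [x, frob q s x]}"
    for w s and \<psi> :: "'k ^ 2 \<Rightarrow> 'k ^ 'n"
  proof -
    have "w 0 = 0" using that(1)[of 0 0] by simp
    then have pts: "kpoints W = {vec.span {w x} | x. x \<noteq> 0}"
      using injD[OF that(2), of _ 0] unfolding kpoints_def that(3)[symmetric] by force
    show ?thesis unfolding L pts that(4)[symmetric] by blast
  qed
  show ?thesis
  proof (intro conjI allI impI ballI)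
    obtain s w \<psi> where "coprime s t"
      and w_all: "\<forall>x y. w (x + y) = w x + w y" "\<forall>c x. w (emb c * x) = emb c *s w x"
        "inj w" "range w = W"
      and \<psi>_all: "\<forall>u v :: 'k ^ 2. \<psi> (u + v) = \<psi> u + \<psi> v" "\<forall>c u. \<psi> (c *s u) = c *s \<psi> u"
        "inj \<psi>" "range \<psi> = M"
      and pw: "\<forall>x. p (w x) = \<psi> (vector [x, frob q s x])"
      by (rule pseudoregulus_representation[OF assms(6) W p(1-4) proj disj L assms(17)])
    note w = w_all[rule_format] and \<psi> = \<psi>_all[rule_format]
    have proj_w: "proj_from G M (vec.span {w x}) = \<psi> ` vec.span {vector [x, frob q s x]}" for x
      by (simp add: proj pw image_span_singleton \<psi>(2))
    have "\<exists>x. x \<noteq> 0 \<and> X = \<psi> ` vec.span {vector [x, frob q s x]}" if "X \<in> r" for X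
      using that \<open>r \<subseteq> L\<close> unfolding L_eq[OF w(1,3,4) proj_w] by blast
    then obtain a b c d h where "b \<noteq> 0" "d \<noteq> 0" "norm_q q t b = norm_q q t d"
      "c / d = frob q h (a / b)" "c / d \<noteq> a / b"
      and r: "r = (`) \<psi> ` {vec.span {vector [emb i * b + emb j * a, emb i * d + emb j * c]} | i j. (i, j) \<noteq> (0, 0)}"
      by (rule conjugate_form_of_subline[OF assms(6) \<psi> assms(18)])
    then show "\<exists>n\<ge>1. nrc_in_subgeometry emb W n (\<Sigma> \<inter> proj_preimage G M r)"
      using nrc_of_subline[OF \<open>coprime s t\<close> w \<psi>(3) proj_w disj r] unfolding \<Sigma> by blast
  next
    fix e \<nu>
    assume *: "coprime \<nu> t \<and> standard_position q \<nu> e \<Sigma> G M"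
    then have "coprime \<nu> t" and std: "standard_position q \<nu> e (kpoints W) G M"
      by (simp_all add: \<Sigma>)
    have "t \<ge> 2" using \<open>t \<ge> 3\<close> by simp
    obtain w where w_all: "\<forall>x y. w (x + y) = w x + w y" "\<forall>c x. w (emb c * x) = emb c *s w x"
        "inj w" "range w = W"
      and proj_w_all: "\<forall>x. proj_from G M (vec.span {w x}) = line_coords e ` vec.span {vector [x, frob q \<nu> x]}"
      by (rule standard_position_representation[OF assms(7,4) \<open>t \<ge> 2\<close> std p(1,2,5) proj])
    note w = w_all[rule_format] and proj_w = proj_w_all[rule_format]
    show L_coords: "L = (`) (line_coords e) ` {vec.span {vector [\<mu>, frob q \<nu> \<mu>]} | \<mu>. \<mu> \<noteq> 0}"
      unfolding L_eq[OF w(1,3,4) proj_w] by blast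
    fix h
    assume "\<exists>T. transversal_line emb {X \<in> kpoints UNIV. line_coords e ` X \<in> r} T \<and>
      (\<exists>Y\<in>S_family emb t h. fpoints emb T \<subseteq> Y)"
    then obtain T k where trans: "transversal_line emb {X \<in> kpoints UNIV. line_coords e ` X \<in> r} T"
      and T_sub: "fpoints emb T \<subseteq> S_set emb h k" and k: "norm_q q t k = 1"
      by (auto simp: S_family_def card_f)
    define R where "R = {X \<in> kpoints UNIV. line_coords e ` X \<in> r}"
    have R_T: "R \<subseteq> kpoints T"
      unfolding R_def using trans by (rule transversal_line_points) blast
    \<comment> \<open>No point of \<open>r\<close> is lost in \<open>R\<close>, since by
      \<open>L_coords\<close> all of them come from the standard line.\<close>
    have r_R: "r = (`) (line_coords e) ` R"
    proof (intro equalityI subsetI)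
      fix X assume "X \<in> r"
      then obtain \<mu> where \<mu>: "\<mu> \<noteq> 0" "X = line_coords e ` vec.span {vector [\<mu>, frob q \<nu> \<mu>]}"
        using \<open>r \<subseteq> L\<close> unfolding L_coords by blast
      moreover have "vec.span {vector [\<mu>, frob q \<nu> \<mu>] :: 'k ^ 2} \<in> kpoints UNIV"
        unfolding kpoints_def
        by (intro CollectI exI[of _ "vector [\<mu>, frob q \<nu> \<mu>]"]) (simp add: vector_2_eq_0_iff \<mu>(1))
      ultimately show "X \<in> (`) (line_coords e) ` R" using \<open>X \<in> r\<close> by (auto simp: R_def)
    qed (auto simp: R_def)
    have "finite R" by (rule finite_subset[of _ "Pow (\<Union>R)"]) auto
    then have card_R: "card R \<ge> q + 1"
      using card_subline_ge[OF assms(18)] card_image_le[of R "(`) (line_coords e)"] unfolding r_R by simp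
    have T: "fsubspace emb T" "fdim emb T = 2"
      using trans by (simp_all add: transversal_line_def)
    have inj: "inj (line_coords e)"
      using std \<open>t \<ge> 2\<close> assms(4) by (intro inj_line_coords) (auto simp: standard_position_def)
    obtain a b c d where "b \<noteq> 0" "d \<noteq> 0" "norm_q q t b = norm_q q t d"
      "c / d = frob q h (a / b)" "c / d \<noteq> a / b"
      and R: "R = {vec.span {vector [emb i * b + emb j * a, emb i * d + emb j * c]} | i j. (i, j) \<noteq> (0, 0)}"
      by (rule subline_of_transversal[OF T R_T card_R fpoints_subset_S_setD[OF T_sub] k])
    then show "\<exists>m n. m > 1 \<and> m dvd t \<and> 1 \<le> n \<and> n \<le> m - 1 \<and>
        [int n = int h * modular_inverse (int m) (int \<nu>)] (mod int m) \<and>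
        nrc_in_subgeometry emb W n (\<Sigma> \<inter> proj_preimage G M r)"
      unfolding \<Sigma> using nrc_of_subline[OF \<open>coprime \<nu> t\<close> w inj proj_w disj r_R[unfolded R]] by blast
  qed
qed

end
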